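(* Let $f:\mathbb{R}\to\mathbb{R}$ be a nonzero, integrable, even function such that $f(0)\le 0$, $\widehat f\in L^1(\mathbb{R})$ and $\widehat f(0)\le 0$. Then $$A(f)\,A(\widehat f)\ \ge\ 0.2025,$$ and the constant $0.2025$ cannot be replaced by $0.353$ (that is, the inequality $A(f)A(\widehat f)\ge 0.353$ does not hold for all functions $f$ satisfying these hypotheses).
   Context: The Fourier transform is normalized by $\widehat f(y)=\int_{\mathbb{R}} f(x)e^{-2\pi i xy}\,dx$. Since $f$ is even and real-valued, $\widehat f$ is even and real-valued. Since $f$ and $\widehat f$ are both integrable, $f$ is identified with its continuous representative. For a real-valued function $g$ on $\mathbb{R}$, $$A(g):=\inf\{r>0:\ g(x)\ge 0 \text{ for all } |x|>r\}\in[0,\infty],$$ with $A(g)=\infty$ if no such $r$ exists. Under the hypotheses on $f$, both $A(f)$ and $A(\widehat f)$ are strictly positive (possibly $\infty$), and the product is taken to be $\infty$ if either factor is $\infty$. *)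

theory Defs
  imports "HOL-Analysis.Analysis"
begin

definition fourier :: "(real \<Rightarrow> real) \<Rightarrow> real \<Rightarrow> complex" where
  "fourier f y =
     (LINT x|lborel. complex_of_real (f x)
        * exp (- 2 * complex_of_real pi * \<i> * complex_of_real x * complex_of_real y))"

text \<open>For even \<open>f\<close> the transform is real-valued, so no information is lost below by passing
  to its real part.\<close>

lemma Im_fourier_even:
  assumes "\<And>x. f (- x) = f x"
  shows "Im (fourier f y) = 0"
proof -
  let ?g = "\<lambda>x. complex_of_real (f x)
        * exp (- 2 * complex_of_real pi * \<i> * complex_of_real x * complex_of_real y)"
  have "fourier f y = (LINT x|lborel. ?g (- x))"
    unfolding fourier_def
    by (subst lborel_integral_real_affine[where c = "-1" and t = 0]) simp_all
  also have "\<dots> = (LINT x|lborel. cnj (?g x))"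
    by (simp add: assms exp_cnj)
  also have "\<dots> = cnj (fourier f y)"
    unfolding fourier_def by (simp only: Bochner_Integration.integral_cnj)
  finally show ?thesis
    by (simp add: complex_eq_iff)
qed

definition fourier_real :: "(real \<Rightarrow> real) \<Rightarrow> real \<Rightarrow> real" where
  "fourier_real f y = Re (fourier f y)"

text \<open>The infimum is taken in the extended nonnegative reals, where the empty set has
  infimum \<open>\<infinity>\<close>. For the functions considered, \<open>A f\<close> and \<open>A (fourier_real f)\<close> are positive, so
  the library convention \<open>0 * \<infinity> = 0\<close> does not matter in their product.\<close>

definition A :: "(real \<Rightarrow> real) \<Rightarrow> ennreal" where
  "A g = Inf {ennreal r | r. r > 0 \<and> (\<forall>x. \<bar>x\<bar> > r \<longrightarrow> g x \<ge> 0)}"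

text \<open>An integrable function with integrable Fourier transform agrees almost everywhere with
  exactly one continuous function. Continuity here expresses that \<open>f\<close> is this representative;
  it gives \<open>f 0\<close> and \<open>A f\<close> their meaning, and makes \<open>f \<noteq> 0\<close> everywhere and almost
  everywhere the same condition.\<close>

definition admissible :: "(real \<Rightarrow> real) \<Rightarrow> bool" where
  "admissible f \<longleftrightarrow>
     continuous_on UNIV f \<and>
     f \<noteq> (\<lambda>x. 0) \<and>
     integrable lborel f \<and>
     (\<forall>x. f (- x) = f x) \<and>
     f 0 \<le> 0 \<and>
     integrable lborel (fourier f) \<and>
     fourier_real f 0 \<le> 0"

end

theory Submission
  imports Defs "HOL-Probability.Probability"
begin

text \<open>
  Lower bound. Suppose the product of \<open>A f\<close> and \<open>A F\<close>, \<open>F\<close> being the transform of \<open>f\<close>, were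
  below \<open>0.2025\<close>. Then there are \<open>a\<close>, \<open>b\<close> with \<open>a b = 0.2025\<close> such that \<open>f\<close> is nonnegative off
  \<open>[-a, a]\<close> and \<open>F\<close> off \<open>[-b, b]\<close>. Compare the weighted masses of the negative parts,
  \<open>P = \<integral> w(s) f\<^sup>-(a s) ds\<close> and \<open>Q = \<integral> w(s) F\<^sup>-(b s) ds\<close> over \<open>[-1, 1]\<close>. Let \<open>N\<close> be the set
  where \<open>f (a s) < 0\<close>. Inserting the inversion formula into \<open>P\<close> and exchanging the integrals gives
  \<open>P = - b \<integral> F(b v) C\<^sub>N(v) dv\<close> with \<open>C\<^sub>N(v) = \<integral>\<^sub>N w(s) cos(\<theta> v s) ds\<close> and
  \<open>\<theta> = 2 \<pi> a b\<close>. As \<open>\<integral> F = f(0) \<le> 0\<close>, adding a constant \<open>c \<ge> 0\<close> to \<open>C\<^sub>N\<close> can only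
  increase the right-hand side. With \<open>c\<close> so large that \<open>C\<^sub>N + c \<ge> 0\<close>, positive values of \<open>F\<close> only
  help, so \<open>P \<le> b \<integral> F\<^sup>-(b v) (C\<^sub>N(v) + c) dv\<close>.

  Everything therefore rests on \<open>0.45 (C\<^sub>N + c) \<le> 0.999 w\<close> on \<open>[-1, 1]\<close>, for every \<open>N\<close>
  (theorem \<open>weighted_cos_diff_bound\<close>). It yields \<open>P \<le> (b / 0.45) 0.999 Q\<close>, and the same argument
  with \<open>f\<close> and \<open>F\<close> exchanged yields \<open>Q \<le> (a / 0.45) 0.999 P\<close>. Since \<open>a b = 0.45\<^sup>2\<close>, together
  they force \<open>P = 0\<close>; so \<open>f \<ge> 0\<close>, and \<open>\<integral> f = F(0) \<le> 0\<close> makes \<open>f\<close> vanish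
  (lemma \<open>sign_uncertainty\<close>).

  The unknown set \<open>N\<close> disappears by estimating \<open>cos(\<theta> x s) - cos(u s)\<close> by its positive part on
  all of \<open>[-1, 1]\<close>, which leaves an inequality in two real variables. For the constant weight it
  is false at \<open>x = 0\<close>; the weight \<open>w(s) = 1 - 0.22 s\<^sup>2 + 0.025 s\<^sup>4\<close> approximates the one for which
  the maximum over \<open>u\<close> of the left-hand side is proportional to \<open>w(x)\<close>, so that the slack
  (about half a percent) is nearly the same for all \<open>x\<close>.

  Upper bound. Hermite functions of degree divisible by 4 are fixed by the transform. A combination
  of those of degree 0, 4, 8, 12 vanishes at 0, has a nearly double zero in \<open>2 \<pi> x\<^sup>2\<close> near 5, and
  is nonnegative as soon as \<open>2 \<pi> x\<^sup>2 \<ge> 2.2175\<close>. This gives the product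
  \<open>2.2175 / (2 \<pi>) < 0.353\<close>.
\<close>

section \<open>Fourier inversion for even functions\<close>

text \<open>For even functions the Fourier transform is this cosine transform; it keeps all later
  integrals real.\<close>

definition cos_transform :: "(real \<Rightarrow> real) \<Rightarrow> real \<Rightarrow> real" where
  "cos_transform f y = (LINT t|lborel. f t * cos (2 * pi * t * y))"

lemma integrable_mult_cos:
  fixes f :: "real \<Rightarrow> real"
  assumes "integrable lborel f"
  shows "integrable lborel (\<lambda>t. f t * cos (c * t * y))"
  by (rule Bochner_Integration.integrable_bound[OF assms])
     (use assms in \<open>auto simp: abs_mult intro!: mult_left_le\<close>)

lemma integrable_mult_cis:
  fixes f :: "real \<Rightarrow> real"
  assumes "integrable lborel f"
  shows "integrable lborel (\<lambda>x. complex_of_real (f x)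
        * exp (- 2 * complex_of_real pi * \<i> * complex_of_real x * complex_of_real y))"
proof (rule Bochner_Integration.integrable_bound[OF assms])
  show "(\<lambda>x. complex_of_real (f x) * exp (- 2 * complex_of_real pi * \<i> * complex_of_real x
      * complex_of_real y)) \<in> borel_measurable lborel"
    using assms by measurable
qed (auto simp: norm_mult)

lemma fourier_real_eq_cos_transform:
  assumes "integrable lborel f"
  shows "fourier_real f = cos_transform f"
proof
  fix y
  have "fourier_real f y = (LINT x|lborel. Re (complex_of_real (f x)
        * exp (- 2 * complex_of_real pi * \<i> * complex_of_real x * complex_of_real y)))"
    unfolding fourier_real_def fourier_def
    by (rule integral_Re[OF integrable_mult_cis[OF assms], symmetric])
  also have "\<dots> = cos_transform f y"
    unfolding cos_transform_def
    by (intro Bochner_Integration.integral_cong) (auto simp: Re_exp)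
  finally show "fourier_real f y = cos_transform f y" .
qed

lemma integrable_gaussian: 
  assumes "n > 0"
  shows "integrable lborel (\<lambda>y::real. exp (- pi * (y / n)\<^sup>2))"
proof -
  define c where "c = sqrt (2 * pi) / n"
  have c: "c \<noteq> 0" using assms by (simp add: c_def)
  have "integrable lborel (\<lambda>y. std_normal_density (0 + c * y))"
    by (subst lborel_integrable_real_affine_iff[OF c])
       (use integrable_std_normal_moment[of 0] in simp)
  then have "integrable lborel (\<lambda>y. sqrt (2 * pi) * std_normal_density (0 + c * y))"
    by simp
  also have "(\<lambda>y. sqrt (2 * pi) * std_normal_density (0 + c * y)) = (\<lambda>y. exp (- pi * (y / n)\<^sup>2))"
    by (auto simp: std_normal_density_def c_def power_mult_distrib power_divide)
  finally show ?thesis .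
qed

lemma cos_transform_gaussian:
  assumes "n > 0"
  shows "cos_transform (\<lambda>y. exp (- pi * (y / n)\<^sup>2)) v = n * exp (- pi * (n * v)\<^sup>2)"
proof -
  define c where "c = sqrt (2 * pi) / n"
  have c: "c > 0" using assms by (simp add: c_def)
  define t where "t = 2 * pi * v / c"
  have int: "integrable lborel (\<lambda>x. std_normal_density x *\<^sub>R iexp (t * x))"
    by (rule Bochner_Integration.integrable_bound[OF integrable_std_normal_moment[of 0]])
       (auto simp: norm_mult)
  have "complex_of_real (exp (- (t\<^sup>2) / 2)) = char std_normal_distribution t"
    by (simp add: char_std_normal_distribution)
  also have "\<dots> = (LINT x|lborel. std_normal_density x *\<^sub>R iexp (t * x))"
    unfolding char_def by (subst integral_density) (auto simp: normal_density_nonneg)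
  finally have "exp (- (t\<^sup>2) / 2) = Re (LINT x|lborel. std_normal_density x *\<^sub>R iexp (t * x))"
    by (metis Re_complex_of_real)
  also have "\<dots> = (LINT x|lborel. Re (std_normal_density x *\<^sub>R iexp (t * x)))"
    by (rule integral_Re[OF int, symmetric])
  also have "\<dots> = (LINT x|lborel. std_normal_density x * cos (t * x))"
    by (intro Bochner_Integration.integral_cong) (auto simp: Re_exp)
  also have "\<dots> = \<bar>c\<bar> *\<^sub>R (LINT y|lborel. std_normal_density (0 + c * y) * cos (t * (0 + c * y)))"
    by (rule lborel_integral_real_affine) (use c in auto)
  also have "(\<lambda>y. std_normal_density (0 + c * y) * cos (t * (0 + c * y)))
      = (\<lambda>y. (1 / sqrt (2 * pi)) * (exp (- pi * (y / n)\<^sup>2) * cos (2 * pi * y * v)))"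
    using c by (auto simp: std_normal_density_def t_def)
               (auto simp: c_def power_mult_distrib power_divide mult_ac)
  finally have "exp (- (t\<^sup>2) / 2) = c / sqrt (2 * pi) * cos_transform (\<lambda>y. exp (- pi * (y / n)\<^sup>2)) v"
    using c by (simp add: cos_transform_def)
  moreover have "t\<^sup>2 / 2 = pi * (n * v)\<^sup>2"
    using assms by (simp add: t_def c_def power_mult_distrib power_divide power2_eq_square field_simps)
  ultimately show ?thesis
    using assms by (simp add: c_def field_simps)
qed

text \<open>A merely integrable \<open>f\<close> may be unbounded, so one dominated convergence argument does not
  suffice: within distance 1 of \<open>x\<close>, \<open>f\<close> is bounded by continuity and substitution turns the kernel
  into a fixed Gaussian; further away the kernels are at most 1 and tend to 0, so \<open>\<bar>f\<bar>\<close> dominates.\<close>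

lemma gaussian_approximate_identity:
  fixes f :: "real \<Rightarrow> real"
  assumes cont: "continuous_on UNIV f" and int: "integrable lborel f"
  shows "(\<lambda>n. LINT t|lborel. f t * (real (Suc n) * exp (- pi * (real (Suc n) * (t - x))\<^sup>2)))
           \<longlonglongrightarrow> f x"
proof -
  let ?K = "\<lambda>n v. real (Suc n) * exp (- pi * (real (Suc n) * v)\<^sup>2)"
  define near where "near t = f t * indicator {x-1..x+1} t" for t
  define far where "far t = f t * indicator (- {x-1..x+1}) t" for t
  have [measurable]: "f \<in> borel_measurable borel" "near \<in> borel_measurable borel"
    "far \<in> borel_measurable borel"
    using int unfolding near_def far_def by auto
  obtain M where M: "\<And>t. t \<in> {x-1..x+1} \<Longrightarrow> \<bar>f t\<bar> \<le> M"
  proof -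
    have "compact (f ` {x-1..x+1})"
      by (intro compact_continuous_image continuous_on_subset[OF cont]) auto
    then have "bounded (f ` {x-1..x+1})" by (rule compact_imp_bounded)
    then obtain M where "\<forall>y\<in>f ` {x-1..x+1}. norm y \<le> M" by (auto simp: bounded_iff)
    then show ?thesis using that[of M] by auto
  qed
  have M0: "0 \<le> M" using M[of x] by (smt (verit) atLeastAtMost_iff)
  have near_bd: "\<bar>near t\<bar> \<le> M" for t
    using M[of t] M0 by (auto simp: near_def indicator_def)
  have lim_near: "(\<lambda>n. LINT v|lborel. near (x + v / real (Suc n)) * exp (- pi * v\<^sup>2))
      \<longlonglongrightarrow> (LINT v|lborel. f x * exp (- pi * v\<^sup>2))"
  proof (rule integral_dominated_convergence[where w = "\<lambda>v. M * exp (- pi * v\<^sup>2)"])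
    show "integrable lborel (\<lambda>v. M * exp (- pi * v\<^sup>2))"
      using integrable_gaussian[of 1] by simp
    show "AE v in lborel. (\<lambda>n. near (x + v / real (Suc n)) * exp (- pi * v\<^sup>2))
        \<longlonglongrightarrow> f x * exp (- pi * v\<^sup>2)"
    proof (intro AE_I2 tendsto_mult tendsto_const)
      fix v
      have to_x: "(\<lambda>n. x + v / real (Suc n)) \<longlonglongrightarrow> x + 0"
        by (intro tendsto_add tendsto_const LIMSEQ_Suc lim_const_over_n)
      then have "(\<lambda>n. f (x + v / real (Suc n))) \<longlonglongrightarrow> f x"
        using cont by (intro isCont_tendsto_compose[of x f]) (auto simp: continuous_on_eq_continuous_at)
      moreover have "\<forall>\<^sub>F n in sequentially. f (x + v / real (Suc n)) = near (x + v / real (Suc n))"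
      proof -
        have "\<forall>\<^sub>F n in sequentially. dist (x + v / real (Suc n)) x < 1"
          using tendstoD[OF to_x, of 1] by simp
        moreover have "f z = near z" if "dist z x < 1" for z
          using that by (auto simp: near_def indicator_def dist_real_def)
        ultimately show ?thesis by (auto elim: eventually_mono)
      qed
      ultimately show "(\<lambda>n. near (x + v / real (Suc n))) \<longlonglongrightarrow> f x"
        by (rule Lim_transform_eventually)
    qed
    show "AE v in lborel. norm (near (x + v / real (Suc n)) * exp (- pi * v\<^sup>2)) \<le> M * exp (- pi * v\<^sup>2)" for n
      using near_bd by (auto simp: abs_mult)
  qed auto
  have near_eq: "(LINT t|lborel. near t * ?K n (t - x))
      = (LINT v|lborel. near (x + v / real (Suc n)) * exp (- pi * v\<^sup>2))" for n
    by (subst lborel_integral_real_affine[where c = "1 / real (Suc n)" and t = x])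
       (auto simp del: of_nat_Suc simp flip: Bochner_Integration.integral_mult_right_zero
         intro!: Bochner_Integration.integral_cong)
  have gauss1: "(LINT v|lborel. f x * exp (- pi * v\<^sup>2)) = f x"
    using cos_transform_gaussian[of 1 0] by (simp add: cos_transform_def)
  have int_far: "integrable lborel far"
    unfolding far_def using int
    by (rule integrable_real_mult_indicator[rotated]) auto
  have int_near: "integrable lborel near"
    unfolding near_def using int
    by (rule integrable_real_mult_indicator[rotated]) auto
  have lim_far: "(\<lambda>n. LINT t|lborel. far t * ?K n (t - x)) \<longlonglongrightarrow> integral\<^sup>L (lborel :: real measure) (\<lambda>_. 0)"
  proof (rule integral_dominated_convergence[where f = "\<lambda>_. 0" and w = "\<lambda>t. \<bar>far t\<bar>"])
    have bd: "?K n v \<le> 1" if "\<bar>v\<bar> \<ge> 1" for n v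
    proof -
      have "1 \<le> v\<^sup>2" using that by (metis one_le_power power2_abs)
      have "real (Suc n) \<le> (real (Suc n))\<^sup>2 * v\<^sup>2 * pi"
      proof -
        have "real (Suc n) * 1 \<le> real (Suc n) * real (Suc n)" by (intro mult_left_mono) auto
        also have "\<dots> = (real (Suc n))\<^sup>2 * 1 * 1" by (simp add: power2_eq_square)
        also have "\<dots> \<le> (real (Suc n))\<^sup>2 * v\<^sup>2 * pi"
          using \<open>1 \<le> v\<^sup>2\<close> pi_ge_two by (intro mult_mono) auto
        finally show ?thesis by simp
      qed
      also have "\<dots> \<le> exp ((real (Suc n))\<^sup>2 * v\<^sup>2 * pi)"
        using exp_ge_add_one_self[of "(real (Suc n))\<^sup>2 * v\<^sup>2 * pi"] by linarith
      finally have "real (Suc n) * exp (- ((real (Suc n))\<^sup>2 * v\<^sup>2 * pi)) \<le> 1"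
        by (simp only: exp_minus divide_inverse[symmetric]) (simp add: field_simps)
      then show ?thesis by (simp only: power_mult_distrib) (simp add: mult_ac)
    qed
    show "AE t in lborel. norm (far t * ?K n (t - x)) \<le> \<bar>far t\<bar>" for n
    proof (intro AE_I2)
      fix t
      show "norm (far t * ?K n (t - x)) \<le> \<bar>far t\<bar>"
      proof (cases "far t = 0")
        case False
        then have "\<bar>t - x\<bar> \<ge> 1" by (auto simp: far_def indicator_def split: if_splits)
        from bd[OF this, of n] show ?thesis
          by (simp only: norm_mult real_norm_def abs_mult[symmetric])
             (simp only: abs_mult, rule mult_left_le, auto)
      qed simp
    qed
    show "AE t in lborel. (\<lambda>n. far t * ?K n (t - x)) \<longlonglongrightarrow> 0"
    proof (intro AE_I2)
      fix t
      show "(\<lambda>n. far t * ?K n (t - x)) \<longlonglongrightarrow> 0"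
      proof (cases "far t = 0")
        case False
        then have ne: "t - x \<noteq> 0" by (auto simp: far_def indicator_def split: if_splits)
        have "(\<lambda>n. real n * exp (- pi * (real n * (t - x))\<^sup>2)) \<longlonglongrightarrow> 0"
          using ne by real_asymp
        then have "(\<lambda>n. ?K n (t - x)) \<longlonglongrightarrow> 0" by (rule LIMSEQ_Suc)
        then show ?thesis by (rule tendsto_mult_right_zero)
      qed simp
    qed
  qed (use int_far in auto)
  have Kb: "integrable lborel (\<lambda>t. h t * ?K n (t - x))" if "integrable lborel h" for h n
  proof (rule Bochner_Integration.integrable_bound)
    show "integrable lborel (\<lambda>t. h t * real (Suc n))" using that by simp
    show "AE t in lborel. norm (h t * ?K n (t - x)) \<le> norm (h t * real (Suc n))"
      by (intro AE_I2) (auto simp: abs_mult intro!: mult_left_mono mult_left_le)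
  qed (use that in auto)
  have split: "(LINT t|lborel. f t * ?K n (t - x))
      = (LINT t|lborel. near t * ?K n (t - x)) + (LINT t|lborel. far t * ?K n (t - x))" for n
    by (subst Bochner_Integration.integral_add[symmetric, OF Kb[OF int_near] Kb[OF int_far]])
       (auto intro!: Bochner_Integration.integral_cong simp: near_def far_def indicator_def)
  have "(\<lambda>n. LINT t|lborel. f t * ?K n (t - x)) \<longlonglongrightarrow> f x + 0"
    unfolding split near_eq
    using tendsto_add[OF lim_near lim_far, unfolded gauss1 Bochner_Integration.integral_zero] .
  then show ?thesis by simp
qed

text \<open>The integrability needed for both uses of Fubini below: inversion, and the exchange of integrals
  in the comparison of negative parts.\<close>

lemma integrable_product_bounded:
  fixes f g :: "real \<Rightarrow> real" and B :: "real \<times> real \<Rightarrow> real"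
  assumes g: "integrable lborel g" and f: "integrable lborel f"
    and B [measurable]: "B \<in> borel_measurable borel" and bd: "\<And>z. \<bar>B z\<bar> \<le> 1"
  shows "integrable (lborel \<Otimes>\<^sub>M lborel) (\<lambda>(y, t). g y * f t * B (y, t))"
proof (rule Bochner_Integration.integrable_bound)
  have [measurable]: "g \<in> borel_measurable borel" "f \<in> borel_measurable borel"
    using f g by auto
  show "integrable (lborel \<Otimes>\<^sub>M lborel) (\<lambda>(y, t). g y * f t)"
  proof (rule lborel_pair.Fubini_integrable)
    show "integrable lborel (\<lambda>y. LINT t|lborel. norm (case (y, t) of (y, t) \<Rightarrow> g y * f t))"
      using g by (simp add: abs_mult)
  qed (use f in auto)
  show "(\<lambda>(y, t). g y * f t * B (y, t)) \<in> borel_measurable (lborel \<Otimes>\<^sub>M lborel)"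
    by measurable
  show "AE z in lborel \<Otimes>\<^sub>M lborel. norm (case z of (y, t) \<Rightarrow> g y * f t * B (y, t))
      \<le> norm (case z of (y, t) \<Rightarrow> g y * f t)"
    using bd by (auto simp: abs_mult intro!: AE_I2 mult_left_le)
qed

text \<open>Damping the outer integrand by the Gaussian \<open>exp (- \<pi> (y / n)\<^sup>2)\<close> makes the double integral
  absolutely convergent; integrating over \<open>y\<close> first turns it into a convolution of \<open>f\<close> with a
  Gaussian of width \<open>1 / n\<close>. Both sides converge as \<open>n\<close> grows.\<close>

theorem cos_transform_inversion:
  fixes f :: "real \<Rightarrow> real"
  assumes cont: "continuous_on UNIV f" and int: "integrable lborel f"
    and even: "\<And>x. f (- x) = f x" and int': "integrable lborel (cos_transform f)"
  shows "cos_transform (cos_transform f) x = f x"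
proof -
  define F where "F = cos_transform f"
  have [measurable]: "f \<in> borel_measurable borel" using int by auto
  have [measurable]: "F \<in> borel_measurable borel" using int' by (auto simp: F_def)
  let ?g = "\<lambda>n y. exp (- pi * (y / real (Suc n))\<^sup>2)"
  have lim1: "(\<lambda>n. LINT y|lborel. F y * cos (2 * pi * y * x) * ?g n y)
     \<longlonglongrightarrow> (LINT y|lborel. F y * cos (2 * pi * y * x))"
  proof (rule integral_dominated_convergence[where w = "\<lambda>y. \<bar>F y\<bar>"])
    show "AE y in lborel. (\<lambda>n. F y * cos (2 * pi * y * x) * ?g n y) \<longlonglongrightarrow> F y * cos (2 * pi * y * x)"
    proof (intro AE_I2)
      fix y
      have "(\<lambda>n. exp (- pi * (y / real n)\<^sup>2)) \<longlonglongrightarrow> exp (- pi * 0\<^sup>2)"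
        by (intro tendsto_intros lim_const_over_n)
      from LIMSEQ_Suc[OF this]
      have "(\<lambda>n. F y * cos (2 * pi * y * x) * ?g n y) \<longlonglongrightarrow> F y * cos (2 * pi * y * x) * exp (- pi * 0\<^sup>2)"
        by (intro tendsto_mult tendsto_const)
      then show "(\<lambda>n. F y * cos (2 * pi * y * x) * ?g n y) \<longlonglongrightarrow> F y * cos (2 * pi * y * x)"
        by simp
    qed
    show "AE y in lborel. norm (F y * cos (2 * pi * y * x) * ?g n y) \<le> \<bar>F y\<bar>" for n
      by (intro AE_I2) (auto simp: abs_mult mult.assoc intro!: mult_left_le mult_le_one)
  qed (use int' in \<open>auto simp: F_def\<close>)
  have reg: "(LINT y|lborel. F y * cos (2 * pi * y * x) * ?g n y)
      = (LINT t|lborel. f t * (real (Suc n) * exp (- pi * (real (Suc n) * (t - x))\<^sup>2)))" for n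
  proof -
    define K where "K v = real (Suc n) * exp (- pi * (real (Suc n) * v)\<^sup>2)" for v
    let ?B = "\<lambda>z. cos (2 * pi * snd z * fst z) * cos (2 * pi * fst z * x)"
    have gi: "integrable lborel (?g n)" by (rule integrable_gaussian) auto
    have K: "(LINT y|lborel. ?g n y * cos (2 * pi * y * v)) = K v" for v
      using cos_transform_gaussian[of "real (Suc n)" v] unfolding cos_transform_def K_def by simp
    have Keven: "K (x - t) = K (t - x)" for t
      unfolding K_def power_mult_distrib by (simp add: power2_commute)
    have Kc: "(LINT y|lborel. c * (?g n y * cos (2 * pi * y * v))) = c * K v" for c v
      by (subst Bochner_Integration.integral_mult_right_zero) (simp only: K)
    have gic: "integrable lborel (\<lambda>y. ?g n y * cos (2 * pi * y * v))" for v
      using integrable_mult_cos[OF gi, of "2 * pi" v] .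
    have fK: "integrable lborel (\<lambda>t. f t * K (t + c))" for c
    proof (rule Bochner_Integration.integrable_bound)
      show "integrable lborel (\<lambda>t. f t * real (Suc n))" using int by simp
      show "(\<lambda>t. f t * K (t + c)) \<in> borel_measurable lborel" unfolding K_def by measurable
      show "AE t in lborel. norm (f t * K (t + c)) \<le> norm (f t * real (Suc n))"
        by (intro AE_I2) (auto simp: K_def abs_mult intro!: mult_left_mono mult_left_le)
    qed
    have intH: "integrable (lborel \<Otimes>\<^sub>M lborel) (\<lambda>(y, t). ?g n y * f t * ?B (y, t))"
    proof (rule integrable_product_bounded[OF gi int])
      show "?B \<in> borel_measurable borel"
        by (intro borel_measurable_continuous_onI continuous_intros)
    qed (auto simp: abs_mult intro!: mult_le_one)
    have "(LINT y|lborel. F y * cos (2 * pi * y * x) * ?g n y)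
        = (LINT y|lborel. (LINT t|lborel. ?g n y * f t * ?B (y, t)))"
    proof (intro Bochner_Integration.integral_cong refl)
      fix y
      have "(LINT t|lborel. ?g n y * f t * ?B (y, t))
          = (LINT t|lborel. (f t * cos (2 * pi * t * y)) * (?g n y * cos (2 * pi * y * x)))"
        by (intro Bochner_Integration.integral_cong refl) simp
      also have "\<dots> = F y * (?g n y * cos (2 * pi * y * x))"
        unfolding F_def cos_transform_def by (rule Bochner_Integration.integral_mult_left_zero)
      finally show "F y * cos (2 * pi * y * x) * ?g n y = (LINT t|lborel. ?g n y * f t * ?B (y, t))"
        by simp
    qed
    also have "\<dots> = (LINT t|lborel. (LINT y|lborel. ?g n y * f t * ?B (y, t)))"
      by (rule lborel_pair.Fubini_integral[symmetric]) (use intH in simp)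
    also have "\<dots> = (LINT t|lborel. f t * K (t - x) / 2 + f t * K (t + x) / 2)"
    proof (intro Bochner_Integration.integral_cong refl)
      fix t
      have "(LINT y|lborel. ?g n y * f t * ?B (y, t))
          = (LINT y|lborel. (f t / 2) * (?g n y * cos (2 * pi * y * (t - x)))
              + (f t / 2) * (?g n y * cos (2 * pi * y * (t + x))))"
      proof (intro Bochner_Integration.integral_cong refl)
        fix y
        have *: "cos (2 * pi * t * y) * cos (2 * pi * y * x)
            = (cos (2 * pi * y * (t - x)) + cos (2 * pi * y * (t + x))) / 2"
          by (simp add: cos_times_cos algebra_simps)
        have "a * b * ((p + q) / 2) = (b / 2) * (a * p) + (b / 2) * (a * q)" for a b p q :: real
          by (simp add: field_simps)
        then show "?g n y * f t * ?B (y, t) = (f t / 2) * (?g n y * cos (2 * pi * y * (t - x)))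
              + (f t / 2) * (?g n y * cos (2 * pi * y * (t + x)))"
          by (simp only: fst_conv snd_conv *)
      qed
      also have "\<dots> = (LINT y|lborel. (f t / 2) * (?g n y * cos (2 * pi * y * (t - x))))
          + (LINT y|lborel. (f t / 2) * (?g n y * cos (2 * pi * y * (t + x))))"
        by (rule Bochner_Integration.integral_add; rule integrable_mult_right, rule gic)
      also have "\<dots> = f t / 2 * K (t - x) + f t / 2 * K (t + x)"
        by (simp only: Kc)
      also have "\<dots> = f t * K (t - x) / 2 + f t * K (t + x) / 2"
        by simp
      finally show "(LINT y|lborel. ?g n y * f t * ?B (y, t)) = f t * K (t - x) / 2 + f t * K (t + x) / 2" .
    qed
    also have "\<dots> = (LINT t|lborel. f t * K (t - x) / 2) + (LINT t|lborel. f t * K (t + x) / 2)"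
      using fK[of x] fK[of "- x"] by (intro Bochner_Integration.integral_add) simp_all
    also have "(LINT t|lborel. f t * K (t + x) / 2) = (LINT t|lborel. f t * K (t - x) / 2)"
      by (subst lborel_integral_real_affine[where c = "-1" and t = 0])
         (simp_all add: even Keven)
    finally show ?thesis by (simp add: K_def)
  qed
  have "(\<lambda>n. LINT y|lborel. F y * cos (2 * pi * y * x) * ?g n y) \<longlonglongrightarrow> f x"
    unfolding reg by (rule gaussian_approximate_identity[OF cont int])
  with lim1 show ?thesis
    unfolding F_def[symmetric] cos_transform_def[of F] by (rule LIMSEQ_unique)
qed

section \<open>Hermite functions and an explicit fixed function of the transform\<close>

text \<open>The Hermite functions, scaled to be eigenfunctions of the transform in the normalization used
  here. In terms of the physicists' polynomials \<open>H\<^sub>n\<close>, the function of index \<open>n\<close> is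
  \<open>(2 \<pi>)\<^bsup>-n/2\<^esup> H\<^sub>n(z) exp (- z\<^sup>2 / 2)\<close> at \<open>z = (2 \<pi>)\<^bsup>1/2\<^esup> x\<close>.\<close>

fun hermite_fun :: "nat \<Rightarrow> real \<Rightarrow> real" where
  "hermite_fun 0 x = exp (- pi * x\<^sup>2)"
| "hermite_fun (Suc 0) x = 2 * x * exp (- pi * x\<^sup>2)"
| "hermite_fun (Suc (Suc n)) x = 2 * x * hermite_fun (Suc n) x - real (Suc n) / pi * hermite_fun n x"

lemma hermite_fun_Suc:
  "hermite_fun (Suc n) x = 2 * x * hermite_fun n x - real n / pi * hermite_fun (n - 1) x"
  by (cases n) auto

text \<open>Differentiation expressed through the neighbouring Hermite functions; together with the defining
  recursion this is all that the proof of the eigenvalue equation uses.\<close>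

lemma hermite_fun_deriv:
  "(hermite_fun n has_real_derivative (real n * hermite_fun (n - 1) x - pi * hermite_fun (Suc n) x)) (at x)"
proof (induction n rule: less_induct)
  case (less n)
  consider "n = 0" | "n = 1" | m where "n = Suc (Suc m)"
    by (metis One_nat_def not0_implies_Suc)
  then show ?case
  proof cases
    case 1
    have "((\<lambda>x. exp (- pi * x\<^sup>2)) has_real_derivative (- 2 * pi * x * exp (- pi * x\<^sup>2))) (at x)"
      by (auto intro!: derivative_eq_intros)
    moreover have "hermite_fun 0 = (\<lambda>x. exp (- pi * x\<^sup>2))" by auto
    ultimately show ?thesis by (simp add: 1 mult_ac)
  next
    case 2
    have "((\<lambda>x. 2 * x * exp (- pi * x\<^sup>2)) has_real_derivative
        (2 * exp (- pi * x\<^sup>2) - 4 * pi * x\<^sup>2 * exp (- pi * x\<^sup>2))) (at x)"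
      by (auto intro!: derivative_eq_intros simp: power2_eq_square)
    moreover have "hermite_fun 1 = (\<lambda>x. 2 * x * exp (- pi * x\<^sup>2))" by auto
    ultimately show ?thesis by (simp add: 2 algebra_simps power2_eq_square)
  next
    case 3
    have d1: "(hermite_fun (Suc m) has_real_derivative
        (real (Suc m) * hermite_fun m x - pi * hermite_fun (Suc (Suc m)) x)) (at x)"
      using less[of "Suc m"] 3 by simp
    have d0: "(hermite_fun m has_real_derivative
        (real m * hermite_fun (m - 1) x - pi * hermite_fun (Suc m) x)) (at x)"
      using less[of m] 3 by simp
    let ?h = "\<lambda>k. hermite_fun k x"
    have "((\<lambda>x. 2 * x * hermite_fun (Suc m) x - real (Suc m) / pi * hermite_fun m x)
        has_real_derivative
        (2 * ?h (Suc m) + 2 * x * (real (Suc m) * ?h m - pi * ?h (Suc (Suc m)))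
          - real (Suc m) / pi * (real m * ?h (m - 1) - pi * ?h (Suc m)))) (at x)"
      by (rule derivative_eq_intros d1 d0 refl | simp)+
    moreover have "hermite_fun n = (\<lambda>x. 2 * x * hermite_fun (Suc m) x - real (Suc m) / pi * hermite_fun m x)"
      using 3 by auto
    moreover have "2 * ?h (Suc m) + 2 * x * (real (Suc m) * ?h m - pi * ?h (Suc (Suc m)))
          - real (Suc m) / pi * (real m * ?h (m - 1) - pi * ?h (Suc m))
        = real n * ?h (n - 1) - pi * ?h (Suc n)"
    proof -
      have "2 * ?h (Suc m) + 2 * x * (real (Suc m) * ?h m - pi * ?h (Suc (Suc m)))
            - real (Suc m) / pi * (real m * ?h (m - 1) - pi * ?h (Suc m))
         = 2 * ?h (Suc m) + real (Suc m) * (2 * x * ?h m - real m / pi * ?h (m - 1))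
            + real (Suc m) * ?h (Suc m) - 2 * pi * x * ?h (Suc (Suc m))"
        by (simp add: field_simps)
      also have "\<dots> = 2 * ?h (Suc m) + real (Suc m) * ?h (Suc m)
            + real (Suc m) * ?h (Suc m) - 2 * pi * x * ?h (Suc (Suc m))"
        by (simp only: hermite_fun_Suc[of m])
      also have "\<dots> = real n * ?h (n - 1) - pi * ?h (Suc n)"
        unfolding 3 hermite_fun_Suc[of "Suc (Suc m)" x]
        by (simp del: hermite_fun.simps add: field_simps)
      finally show ?thesis .
    qed
    ultimately show ?thesis by (simp only:)
  qed
qed

lemma continuous_hermite_fun: "continuous_on UNIV (hermite_fun n)"
  using hermite_fun_deriv by (metis DERIV_isCont continuous_on_eq_continuous_at open_UNIV)

lemma isCont_hermite_fun [simp]: "isCont (hermite_fun n) x"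
  using hermite_fun_deriv by (metis DERIV_isCont)

lemma hermite_fun_measurable [measurable]: "hermite_fun n \<in> borel_measurable borel"
  by (rule borel_measurable_continuous_onI) (rule continuous_hermite_fun)

lemma integrable_power_mult_gaussian: "integrable lborel (\<lambda>x::real. x ^ k * exp (- pi * x\<^sup>2))"
proof -
  define c where "c = sqrt (2 * pi)"
  have c: "c > 0" by (simp add: c_def)
  have "integrable lborel (\<lambda>y. std_normal_density (0 + c * y) * (0 + c * y) ^ k)"
    by (subst lborel_integrable_real_affine_iff) (use c integrable_std_normal_moment[of k] in auto)
  then have "integrable lborel (\<lambda>y. (c / c ^ k) * (std_normal_density (0 + c * y) * (0 + c * y) ^ k))"
    by simp
  also have "(\<lambda>y. (c / c ^ k) * (std_normal_density (0 + c * y) * (0 + c * y) ^ k))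
     = (\<lambda>y. y ^ k * exp (- pi * y\<^sup>2))"
    using c by (auto simp: std_normal_density_def power_mult_distrib) (auto simp: c_def)
  finally show ?thesis .
qed

lemma integrable_power_mult_hermite_fun: "integrable lborel (\<lambda>x. x ^ k * hermite_fun n x)"
proof (induction n arbitrary: k rule: induct_nat_012)
  case 0
  then show ?case using integrable_power_mult_gaussian by simp
next
  case 1
  have "integrable lborel (\<lambda>x. 2 * (x ^ Suc k * exp (- pi * x\<^sup>2)))"
    using integrable_power_mult_gaussian by (intro integrable_mult_right)
  then show ?case by (simp add: mult_ac)
next
  case (ge2 n)
  have "integrable lborel (\<lambda>x. 2 * (x ^ Suc k * hermite_fun (Suc n) x)
     - real (Suc n) / pi * (x ^ k * hermite_fun n x))"
    by (intro Bochner_Integration.integrable_diff integrable_mult_right ge2)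
  then show ?case by (simp add: algebra_simps)
qed

lemma integrable_hermite_fun: "integrable lborel (hermite_fun n)"
  using integrable_power_mult_hermite_fun[of 0 n] by simp

lemma hermite_fun_vanishes_at_infinity:
  assumes F: "\<And>k. ((\<lambda>x::real. x ^ k * exp (- pi * x\<^sup>2)) \<longlongrightarrow> 0) F"
  shows "((\<lambda>x. x ^ k * hermite_fun n x) \<longlongrightarrow> 0) F"
proof (induction n arbitrary: k rule: induct_nat_012)
  case 0
  then show ?case using F by simp
next
  case 1
  have "((\<lambda>x. 2 * (x ^ Suc k * exp (- pi * x\<^sup>2))) \<longlongrightarrow> 0) F"
    by (rule tendsto_mult_right_zero[OF F])
  then show ?case by (simp add: mult_ac)
next
  case (ge2 n)
  have "((\<lambda>x. 2 * (x ^ Suc k * hermite_fun (Suc n) x)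
     - real (Suc n) / pi * (x ^ k * hermite_fun n x)) \<longlongrightarrow> 0 - 0) F"
    by (intro tendsto_diff tendsto_mult_right_zero ge2)
  then show ?case by (simp add: algebra_simps)
qed

lemma hermite_fun_tendsto_0:
  "(hermite_fun n \<longlongrightarrow> 0) at_top" "(hermite_fun n \<longlongrightarrow> 0) at_bot"
proof -
  have "((\<lambda>x. x ^ k * exp (- pi * x\<^sup>2)) \<longlongrightarrow> 0) at_top" for k
    by real_asymp
  from hermite_fun_vanishes_at_infinity[OF this, of 0 n]
  show "(hermite_fun n \<longlongrightarrow> 0) at_top" by simp
  have "((\<lambda>x::real. x ^ k * exp (- pi * x\<^sup>2)) \<longlongrightarrow> 0) at_bot" for k
    by real_asymp
  from hermite_fun_vanishes_at_infinity[OF this, of 0 n]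
  show "(hermite_fun n \<longlongrightarrow> 0) at_bot" by simp
qed

text \<open>The derivative of \<open>hermite_fun n x * exp (- 2 \<pi> i x y)\<close> has integral 0 over the line, because
  the function vanishes at both ends. Expanding that derivative gives the recursion. Integration by
  parts avoids differentiating the transform under the integral sign.\<close>

lemma fourier_hermite_fun_Suc:
  "pi * fourier (hermite_fun (Suc n)) y
    = real n * fourier (hermite_fun (n - 1)) y - 2 * pi * \<i> * y * fourier (hermite_fun n) y"
proof -
  define e where "e x = exp (- 2 * complex_of_real pi * \<i> * complex_of_real x * complex_of_real y)" for x
  define G' where "G' x = complex_of_real (real n) * (complex_of_real (hermite_fun (n - 1) x) * e x)
      - complex_of_real pi * (complex_of_real (hermite_fun (Suc n) x) * e x)
      - 2 * pi * \<i> * y * (complex_of_real (hermite_fun n x) * e x)" for x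
  have int: "integrable lborel (\<lambda>x. complex_of_real (hermite_fun k x) * e x)" for k
    unfolding e_def by (rule integrable_mult_cis[OF integrable_hermite_fun])
  have F: "(LINT x|lborel. complex_of_real (hermite_fun k x) * e x) = fourier (hermite_fun k) y" for k
    unfolding fourier_def e_def ..
  have norm_e: "norm (e x) = 1" for x by (simp add: e_def)
  have cont_e: "isCont e x" for x unfolding e_def by (intro continuous_intros)
  have int': "integrable lborel G'"
    unfolding G'_def by (intro Bochner_Integration.integrable_diff integrable_mult_right int)
  have lim: "((\<lambda>x. complex_of_real (hermite_fun n x) * e x) \<longlongrightarrow> 0) F"
    if "(hermite_fun n \<longlongrightarrow> 0) F" for F
  proof (rule tendsto_norm_zero_cancel)
    show "((\<lambda>x. norm (complex_of_real (hermite_fun n x) * e x)) \<longlongrightarrow> 0) F"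
      using tendsto_norm_zero[OF that] by (simp add: norm_mult norm_e)
  qed
  have "(LBINT x=-\<infinity>..\<infinity>. G' x) = 0 - 0"
  proof (rule interval_integral_FTC_integrable)
    fix x
    have "(e has_vector_derivative (- 2 * pi * \<i> * y) * e x) (at x)"
      unfolding e_def
      by (rule has_vector_derivative_real_field) (auto intro!: derivative_eq_intros)
    moreover have "((\<lambda>x. complex_of_real (hermite_fun n x)) has_vector_derivative
       complex_of_real (real n * hermite_fun (n - 1) x - pi * hermite_fun (Suc n) x)) (at x)"
      by (intro has_vector_derivative_of_real hermite_fun_deriv)
    ultimately have "((\<lambda>x. complex_of_real (hermite_fun n x) * e x) has_vector_derivative
        (complex_of_real (hermite_fun n x) * ((- 2 * pi * \<i> * y) * e x)
        + complex_of_real (real n * hermite_fun (n - 1) x - pi * hermite_fun (Suc n) x) * e x)) (at x)"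
      by (intro has_vector_derivative_mult)
    then show "((\<lambda>x. complex_of_real (hermite_fun n x) * e x) has_vector_derivative G' x) (at x)"
      by (simp add: G'_def algebra_simps del: hermite_fun.simps)
    show "isCont G' x"
      unfolding G'_def by (intro continuous_intros isCont_hermite_fun cont_e)
  next
    show "set_integrable lborel (einterval (- \<infinity>) \<infinity>) G'"
      using int' by (simp add: set_integrable_def)
    show "(((\<lambda>x. complex_of_real (hermite_fun n x) * e x) \<circ> real_of_ereal) \<longlongrightarrow> 0) (at_right (- \<infinity>))"
      by (subst ereal_tendsto_simps) (rule lim[OF hermite_fun_tendsto_0(2)])
    show "(((\<lambda>x. complex_of_real (hermite_fun n x) * e x) \<circ> real_of_ereal) \<longlongrightarrow> 0) (at_left \<infinity>)"
      by (subst ereal_tendsto_simps) (rule lim[OF hermite_fun_tendsto_0(1)])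
  qed simp
  then have "0 = (LINT x|lborel. G' x)"
    by (simp add: interval_lebesgue_integral_def set_lebesgue_integral_def)
  also have "\<dots> = complex_of_real (real n) * fourier (hermite_fun (n - 1)) y
      - complex_of_real pi * fourier (hermite_fun (Suc n)) y
      - 2 * pi * \<i> * y * fourier (hermite_fun n) y"
    unfolding G'_def F[symmetric]
    by (simp add: int del: hermite_fun.simps)
  finally show ?thesis by (simp add: algebra_simps)
qed

text \<open>The transforms satisfy the recursion of the functions themselves, up to the factor \<open>- i\<close> in each
  step.\<close>

theorem fourier_hermite_fun: "fourier (hermite_fun n) y = (- \<i>) ^ n * hermite_fun n y"
proof (induction n rule: less_induct)
  case (less n)
  show ?case
  proof (cases n)
    case 0
    have "hermite_fun 0 = (\<lambda>x. exp (- pi * (x / 1)\<^sup>2))" by auto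
    then have "fourier_real (hermite_fun 0) y = hermite_fun 0 y"
      using fourier_real_eq_cos_transform[OF integrable_hermite_fun[of 0]] cos_transform_gaussian[of 1 y]
      by simp
    moreover have "Im (fourier (hermite_fun 0) y) = 0"
      by (rule Im_fourier_even) simp
    ultimately show ?thesis
      using 0 by (simp add: complex_eq_iff fourier_real_def del: hermite_fun.simps)
  next
    case (Suc m)
    have IH: "fourier (hermite_fun m) y = (- \<i>) ^ m * hermite_fun m y"
      "fourier (hermite_fun (m - 1)) y = (- \<i>) ^ (m - 1) * hermite_fun (m - 1) y"
      using less[of m] less[of "m - 1"] Suc by auto
    have pw: "real m * (- \<i>) ^ (m - 1) = - (real m * (- \<i>) ^ Suc m)"
      by (cases m) auto
    have "pi * fourier (hermite_fun (Suc m)) y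
       = real m * (- \<i>) ^ (m - 1) * hermite_fun (m - 1) y
           - 2 * pi * \<i> * y * ((- \<i>) ^ m * hermite_fun m y)"
      unfolding fourier_hermite_fun_Suc IH by simp
    also have "\<dots> = (- \<i>) ^ Suc m * (2 * pi * y * hermite_fun m y - real m * hermite_fun (m - 1) y)"
      unfolding pw by (simp add: algebra_simps)
    also have "2 * pi * y * hermite_fun m y - real m * hermite_fun (m - 1) y = pi * hermite_fun (Suc m) y"
      by (simp add: hermite_fun_Suc field_simps del: hermite_fun.simps)
    finally have "complex_of_real pi * fourier (hermite_fun (Suc m)) y
        = complex_of_real pi * ((- \<i>) ^ Suc m * hermite_fun (Suc m) y)"
      by (simp add: mult_ac del: hermite_fun.simps)
    then show ?thesis
      unfolding Suc by (subst (asm) mult_left_cancel) auto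
  qed
qed


text \<open>With \<open>u = 2 \<pi> x\<^sup>2\<close> the four terms are polynomials in \<open>u\<close> times \<open>exp (- \<pi> x\<^sup>2)\<close>. The
  coefficients approximate the combination with a zero at 0 and a double zero near \<open>u = 5\<close>, whose last
  sign change, near \<open>u = 2.212\<close>, is the smallest possible; integers were chosen so that the value at 0 is
  exactly 0 and a little room remains below \<open>2.2175\<close>.\<close>

definition example_fun :: "real \<Rightarrow> real" where
  "example_fun x = hermite_fun 12 x * pi ^ 6 + 357 * pi ^ 4 * hermite_fun 8 x
     + 11700 * pi\<^sup>2 * hermite_fun 4 x - 82980 * hermite_fun 0 x"

lemma fourier_example_fun: "fourier example_fun y = complex_of_real (example_fun y)"
proof -
  define e where "e x = exp (- 2 * complex_of_real pi * \<i> * complex_of_real x * complex_of_real y)" for x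
  have int: "integrable lborel (\<lambda>x. complex_of_real (hermite_fun k x) * e x)" for k
    unfolding e_def by (rule integrable_mult_cis[OF integrable_hermite_fun])
  have F: "(LINT x|lborel. complex_of_real (hermite_fun k x) * e x) = fourier (hermite_fun k) y" for k
    unfolding fourier_def e_def ..
  have "fourier example_fun y = (LINT x|lborel. pi ^ 6 * (complex_of_real (hermite_fun 12 x) * e x)
      + (357 * pi ^ 4) * (complex_of_real (hermite_fun 8 x) * e x)
      + (11700 * pi\<^sup>2) * (complex_of_real (hermite_fun 4 x) * e x)
      - 82980 * (complex_of_real (hermite_fun 0 x) * e x))"
    unfolding fourier_def example_fun_def e_def
    by (intro Bochner_Integration.integral_cong) (simp_all add: algebra_simps)
  also have "\<dots> = pi ^ 6 * fourier (hermite_fun 12) y + (357 * pi ^ 4) * fourier (hermite_fun 8) y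
      + (11700 * pi\<^sup>2) * fourier (hermite_fun 4) y - 82980 * fourier (hermite_fun 0) y"
    unfolding F[symmetric] using int by (simp del: hermite_fun.simps)
  also have "\<dots> = complex_of_real (example_fun y)"
    unfolding fourier_hermite_fun example_fun_def by (simp add: power_mult[of "-\<i>" 4, simplified] del: hermite_fun.simps)
  finally show ?thesis .
qed

text \<open>Two steps of the recursion at once, to stay within the even degrees, where only \<open>x\<^sup>2\<close> occurs.\<close>

lemma hermite_fun_step2:
  "pi\<^sup>2 * hermite_fun (n + 4) x = pi * (4 * pi * x\<^sup>2 - real (2 * n + 5)) * hermite_fun (n + 2) x
     - real ((n + 1) * (n + 2)) * hermite_fun n x"
proof -
  have e: "n + 4 = Suc (Suc (Suc (Suc n)))" "n + 3 = Suc (Suc (Suc n))" "n + 2 = Suc (Suc n)"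
    "n + 1 = Suc n" by simp_all
  have 1: "pi * hermite_fun (n + 2) x = pi * (2 * x * hermite_fun (n + 1) x) - (real n + 1) * hermite_fun n x"
    unfolding e hermite_fun.simps(3)[of n] by (simp add: field_simps del: hermite_fun.simps)
  have 2: "pi * hermite_fun (n + 3) x = pi * (2 * x * hermite_fun (n + 2) x) - (real n + 2) * hermite_fun (n + 1) x"
    unfolding e hermite_fun.simps(3)[of "Suc n"] by (simp add: field_simps del: hermite_fun.simps)
  have 3: "pi * hermite_fun (n + 4) x = pi * (2 * x * hermite_fun (n + 3) x) - (real n + 3) * hermite_fun (n + 2) x"
    unfolding e hermite_fun.simps(3)[of "Suc (Suc n)"] by (simp add: field_simps del: hermite_fun.simps)
  have "pi\<^sup>2 * hermite_fun (n + 4) x = pi * (2 * x) * (pi * hermite_fun (n + 3) x)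
      - pi * (real n + 3) * hermite_fun (n + 2) x"
    using 3 by algebra
  also have "\<dots> = pi\<^sup>2 * (4 * x\<^sup>2 * hermite_fun (n + 2) x) - (real n + 2) * (pi * (2 * x * hermite_fun (n + 1) x))
      - pi * (real n + 3) * hermite_fun (n + 2) x"
    unfolding 2 by algebra
  also have "pi * (2 * x * hermite_fun (n + 1) x) = pi * hermite_fun (n + 2) x + (real n + 1) * hermite_fun n x"
    using 1 by simp
  finally show ?thesis by (simp add: algebra_simps power2_eq_square del: hermite_fun.simps)
qed

lemma example_fun_eq:
  defines "u \<equiv> \<lambda>x. 2 * pi * x\<^sup>2"
  shows "example_fun x = 4 * u x * (16 * u x ^ 5 - 528 * u x ^ 4 + 7368 * u x ^ 3 - 47712 * u x ^ 2
      + 138645 * u x - 141255) * exp (- pi * x\<^sup>2)"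
proof -
  define g where "g j = pi ^ j * hermite_fun (2 * j) x" for j
  define v where "v = u x"
  define e where "e = exp (- pi * x\<^sup>2)"
  have step: "g (j + 2) = (2 * v - real (4 * j + 5)) * g (j + 1) - real ((2 * j + 1) * (2 * j + 2)) * g j" for j
  proof -
    have "g (j + 2) = pi ^ j * (pi\<^sup>2 * hermite_fun (2 * j + 4) x)"
      by (simp only: g_def power_add distrib_left) (simp add: mult_ac del: hermite_fun.simps)
    also have "\<dots> = pi ^ j * (pi * (4 * pi * x\<^sup>2 - real (4 * j + 5)) * hermite_fun (2 * j + 2) x
       - real ((2 * j + 1) * (2 * j + 2)) * hermite_fun (2 * j) x)"
      unfolding hermite_fun_step2 by (simp add: mult_ac del: hermite_fun.simps)
    also have "\<dots> = (2 * v - real (4 * j + 5)) * g (j + 1) - real ((2 * j + 1) * (2 * j + 2)) * g j"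
      by (simp add: g_def v_def u_def algebra_simps del: hermite_fun.simps)
    finally show ?thesis .
  qed
  have g0: "g 0 = e" by (simp add: g_def e_def)
  have g1: "g 1 = (2 * v - 1) * e"
    by (simp add: g_def e_def v_def u_def eval_nat_numeral field_simps)
  have g2: "g 2 = (4 * v^2 - 12 * v + 3) * e"
    using step[of 0] g0 g1
    by (simp del: One_nat_def add_2_eq_Suc') (simp add: algebra_simps power2_eq_square)
  have g3: "g 3 = (2 * v - 9) * g 2 - 12 * g 1"
    using step[of 1] by (simp del: One_nat_def)
  have g4: "g 4 = (2 * v - 13) * g 3 - 30 * g 2"
    using step[of 2] by simp
  have g5: "g 5 = (2 * v - 17) * g 4 - 56 * g 3"
    using step[of 3] by simp
  have g6: "g 6 = (2 * v - 21) * g 5 - 90 * g 4"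
    using step[of 4] by simp
  have "example_fun x = g 6 + 357 * g 4 + 11700 * g 2 - 82980 * g 0"
    by (simp add: example_fun_def g_def)
  also have "\<dots> = 4 * v * (16 * v ^ 5 - 528 * v ^ 4 + 7368 * v ^ 3 - 47712 * v ^ 2
      + 138645 * v - 141255) * e"
    unfolding g6 g5 g4 g3 g2 g1 g0 by algebra
  finally show ?thesis by (simp add: v_def e_def)
qed

text \<open>After the factor \<open>u\<close>, division by \<open>(u - 2.2175) (u - 5)\<^sup>2\<close> leaves a positive definite quotient and
  a positive definite quadratic remainder.\<close>

lemma example_fun_nonneg:
  assumes "2 * pi * x\<^sup>2 \<ge> 887 / 400"
  shows "example_fun x \<ge> 0"
proof -
  define u where "u = 2 * pi * x\<^sup>2"
  have u: "u \<ge> 887 / 400" using assms by (simp add: u_def)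
  have "4 * (16 * u ^ 5 - 528 * u ^ 4 + 7368 * u ^ 3 - 47712 * u ^ 2 + 138645 * u - 141255)
    = (u - 887 / 400) * (u - 5)\<^sup>2 * (64 * u\<^sup>2 - 33252 / 25 * u + 25506369 / 2500)
      + (96149303 / 1000000 * u\<^sup>2 - 46149303 / 100000 * u + 23349303 / 40000)"
    by (simp add: power2_eq_square eval_nat_numeral field_simps)
  also have "64 * u\<^sup>2 - 33252 / 25 * u + 25506369 / 2500 = 64 * (u - 8313 / 800)\<^sup>2 + 32919507 / 10000"
    by (simp add: power2_eq_square field_simps)
  also have "(u - 887 / 400) * (u - 5)\<^sup>2 * (64 * (u - 8313 / 800)\<^sup>2 + 32919507 / 10000)
      + (96149303 / 1000000 * u\<^sup>2 - 46149303 / 100000 * u + 23349303 / 40000) \<ge> 0"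
  proof (rule add_nonneg_nonneg)
    show "(u - 887 / 400) * (u - 5)\<^sup>2 * (64 * (u - 8313 / 800)\<^sup>2 + 32919507 / 10000) \<ge> 0"
      using u by (intro mult_nonneg_nonneg add_nonneg_nonneg) auto
    have "96149303 / 1000000 * u\<^sup>2 - 46149303 / 100000 * u + 23349303 / 40000
        = 46149303 / 480000 * (u - 12 / 5)\<^sup>2 + 492175 / 10 ^ 8 * u\<^sup>2 + 29940939 / 1000000"
      by (simp add: power2_eq_square field_simps)
    also have "\<dots> \<ge> 0" by (intro add_nonneg_nonneg mult_nonneg_nonneg) auto
    finally show "96149303 / 1000000 * u\<^sup>2 - 46149303 / 100000 * u + 23349303 / 40000 \<ge> 0" .
  qed
  finally have "16 * u ^ 5 - 528 * u ^ 4 + 7368 * u ^ 3 - 47712 * u ^ 2 + 138645 * u - 141255 \<ge> 0"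
    by simp
  then show ?thesis
    unfolding example_fun_eq u_def[symmetric] using u by (simp add: mult_ac)
qed


lemma A_example_fun_le: "A example_fun \<le> ennreal (sqrt (887 / (800 * pi)))"
proof -
  let ?r = "sqrt (887 / (800 * pi))"
  have "example_fun x \<ge> 0" if "\<bar>x\<bar> > ?r" for x
  proof (rule example_fun_nonneg)
    have "887 / (800 * pi) = ?r\<^sup>2" by simp
    also have "\<dots> \<le> \<bar>x\<bar>\<^sup>2" using that by (intro power_mono) auto
    finally show "2 * pi * x\<^sup>2 \<ge> 887 / 400" by (simp add: field_simps)
  qed
  then show ?thesis
    unfolding A_def by (intro Inf_lower) (auto intro!: exI[of _ ?r])
qed

lemma fourier_real_example_fun: "fourier_real example_fun = example_fun"
  by (simp add: fun_eq_iff fourier_real_def fourier_example_fun)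

lemma admissible_example_fun: "admissible example_fun"
proof -
  have int: "integrable lborel example_fun"
    unfolding example_fun_def
    by (intro Bochner_Integration.integrable_add Bochner_Integration.integrable_diff
          integrable_mult_right integrable_mult_left integrable_hermite_fun)
  have "example_fun (1 / sqrt (2 * pi)) \<noteq> 0"
    unfolding example_fun_eq by (simp add: power_divide)
  then have "example_fun \<noteq> (\<lambda>x. 0)" by metis
  moreover have "continuous_on UNIV example_fun"
    unfolding example_fun_eq[abs_def] by (intro continuous_intros)
  moreover have "integrable lborel (fourier example_fun)"
    using int by (simp add: fourier_example_fun[abs_def])
  moreover have "example_fun (- x) = example_fun x" "example_fun 0 = 0" for x
    by (simp_all add: example_fun_eq)
  ultimately show ?thesis
    unfolding admissible_def fourier_real_example_fun
    using int by auto
qed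

lemma constant_upper_bound:
  "\<not> (\<forall>f. admissible f \<longrightarrow> A f * A (fourier_real f) \<ge> ennreal 0.353)"
proof -
  let ?r = "sqrt (887 / (800 * pi))"
  have "A example_fun * A (fourier_real example_fun) \<le> ennreal ?r * ennreal ?r"
    unfolding fourier_real_example_fun by (intro mult_mono A_example_fun_le) auto
  also have "\<dots> = ennreal (887 / (800 * pi))"
    by (simp flip: ennreal_mult)
  also have "\<dots> < ennreal 0.353"
    using pi_approx by (intro ennreal_lessI) (auto simp: field_simps)
  finally show ?thesis
    using admissible_example_fun by (auto simp: not_le)
qed

section \<open>Lower bounds of polynomials on intervals\<close>

text \<open>A polynomial is given by the list of its coefficients, so that the simplifier can evaluate exact
  lower bounds on intervals: shift the left end of the interval to 0, then run Horner's scheme with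
  interval arithmetic on \<open>[0, d]\<close>.\<close>

primrec poly_list :: "real list \<Rightarrow> real \<Rightarrow> real" where
  "poly_list [] t = 0"
| "poly_list (c # cs) t = c + t * poly_list cs t"

primrec mul_linear_add :: "real \<Rightarrow> real \<Rightarrow> real list \<Rightarrow> real list" where
  "mul_linear_add a b [] = [b]"
| "mul_linear_add a b (c # cs) = (b + a * c) # mul_linear_add a c cs"

primrec taylor_shift :: "real \<Rightarrow> real list \<Rightarrow> real list" where
  "taylor_shift a [] = []"
| "taylor_shift a (c # cs) = mul_linear_add a c (taylor_shift a cs)"

primrec horner_lower :: "real \<Rightarrow> real list \<Rightarrow> real" where
  "horner_lower d [] = 0"
| "horner_lower d (c # cs) = c + min 0 (d * horner_lower d cs)"

lemma poly_list_mul_linear_add: "poly_list (mul_linear_add a b cs) t = b + (t + a) * poly_list cs t"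
  by (induction cs arbitrary: b) (simp_all add: algebra_simps)

lemma poly_list_taylor_shift: "poly_list (taylor_shift a cs) t = poly_list cs (t + a)"
  by (induction cs) (simp_all add: poly_list_mul_linear_add)

lemma horner_lower_le:
  assumes "0 \<le> t" "t \<le> d"
  shows "horner_lower d cs \<le> poly_list cs t"
proof (induction cs)
  case (Cons c cs)
  have "min 0 (d * horner_lower d cs) \<le> t * horner_lower d cs"
    using assms by (cases "horner_lower d cs \<ge> 0") (auto simp: min_le_iff_disj intro: mult_right_mono_neg)
  also have "\<dots> \<le> t * poly_list cs t"
    using assms Cons by (intro mult_left_mono) auto
  finally show ?case by simp
qed simp

text \<open>Useful on short intervals, where the shifted coefficients beyond the first contribute little.\<close>

lemma poly_list_lower_bound:
  assumes "a \<le> z" "z \<le> b"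
  shows "horner_lower (b - a) (taylor_shift a cs) \<le> poly_list cs z"
  using horner_lower_le[of "z - a" "b - a" "taylor_shift a cs"] assms
  by (simp add: poly_list_taylor_shift)

text \<open>With \<open>z = u\<^sup>2 / 40\<close>, a lower bound for \<open>0.159 + 0.45 \<integral> w(s) cos(u s) ds\<close>: the Taylor
  polynomial of the cosine is integrated term by term and each coefficient is rounded down to six
  decimals; the last one is the Lagrange remainder. The scaling by 40 keeps the coefficients of
  comparable size for \<open>u \<le> 6.2\<close>.\<close>

definition cos_poly :: "real list" where
  "cos_poly = [399/400, -2636143/500000, 1285119/125000, -1930967/200000, 5316239/1000000,
     -960669/500000, 490443/1000000, -93099/1000000, 6827/500000, -797/500000, -19/125000]"

text \<open>The range \<open>u \<le> 5\<close>. The polynomial has a minimum of about \<open>0.0027\<close> near \<open>z = 0.53\<close>, that is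
  \<open>u = 4.6\<close>, which dictates the short intervals there. This minimum is the critical point of the
  lower bound.\<close>

lemma cos_poly_nonneg:
  assumes "0 \<le> z" "z \<le> 5/8"
  shows "0 \<le> poly_list cos_poly z"
proof -
  have *: "0 \<le> poly_list cos_poly z" if "0 \<le> horner_lower (b - a) (taylor_shift a cos_poly)" "a \<le> z" "z \<le> b" for a b
    using poly_list_lower_bound[OF that(2,3), of cos_poly] that(1) by simp
  consider "z \<in> {0..18/100}" | "z \<in> {18/100..31/100}" | "z \<in> {31/100..40/100}" | "z \<in> {40/100..46/100}"
    | "z \<in> {46/100..50/100}" | "z \<in> {50/100..54/100}" | "z \<in> {54/100..5/8}"
    using assms by fastforce
  then show ?thesis
  proof cases
    case 1
    show ?thesis by (rule *[of "18/100" 0]) (use 1 in \<open>auto simp: cos_poly_def\<close>)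
  next
    case 2
    show ?thesis by (rule *[of "31/100" "18/100"]) (use 2 in \<open>auto simp: cos_poly_def\<close>)
  next
    case 3
    show ?thesis by (rule *[of "40/100" "31/100"]) (use 3 in \<open>auto simp: cos_poly_def\<close>)
  next
    case 4
    show ?thesis by (rule *[of "46/100" "40/100"]) (use 4 in \<open>auto simp: cos_poly_def\<close>)
  next
    case 5
    show ?thesis by (rule *[of "50/100" "46/100"]) (use 5 in \<open>auto simp: cos_poly_def\<close>)
  next
    case 6
    show ?thesis by (rule *[of "54/100" "50/100"]) (use 6 in \<open>auto simp: cos_poly_def\<close>)
  next
    case 7
    show ?thesis by (rule *[of "5/8" "54/100"]) (use 7 in \<open>auto simp: cos_poly_def\<close>)
  qed
qed

text \<open>The range \<open>5 \<le> u \<le> 6.2\<close>. The line dominates \<open>0.108617 (u - 5)\<close>: it is the tangent, as a function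
  of \<open>u\<^sup>2\<close>, at \<open>u = 5.6\<close> of this concave function.\<close>

lemma cos_poly_ge_line:
  assumes "5/8 \<le> z" "z \<le> 961/1000"
  shows "108617/1000000 * ((40 * z - 2464/100) / (112/10)) \<le> poly_list cos_poly z"
proof -
  define cs where "cs = (hd cos_poly + 108617/1000000 * (2464/1120)) #
      (hd (tl cos_poly) - 108617/1000000 * (400/112)) # tl (tl cos_poly)"
  have *: "0 \<le> poly_list cs z" if "0 \<le> horner_lower (b - a) (taylor_shift a cs)" "a \<le> z" "z \<le> b" for a b
    using poly_list_lower_bound[OF that(2,3), of cs] that(1) by simp
  consider "z \<in> {5/8..695/1000}" | "z \<in> {695/1000..785/1000}" | "z \<in> {785/1000..961/1000}"
    using assms by fastforce
  then have "0 \<le> poly_list cs z"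
  proof cases
    case 1
    show ?thesis by (rule *[of "695/1000" "5/8"]) (use 1 in \<open>auto simp: cos_poly_def cs_def\<close>)
  next
    case 2
    show ?thesis by (rule *[of "785/1000" "695/1000"]) (use 2 in \<open>auto simp: cos_poly_def cs_def\<close>)
  next
    case 3
    show ?thesis by (rule *[of "961/1000" "785/1000"]) (use 3 in \<open>auto simp: cos_poly_def cs_def\<close>)
  qed
  then show ?thesis
    unfolding cs_def cos_poly_def by (simp add: field_simps)
qed

section \<open>Integrals against the weight\<close>

definition weight :: "real \<Rightarrow> real" where
  "weight s = 1 - 11/50 * s\<^sup>2 + 1/40 * s ^ 4"

definition wint :: "(real \<Rightarrow> real) \<Rightarrow> real" where
  "wint f = (LINT s:{-1..1}|lborel. weight s * f s)"

text \<open>The weighted integral of \<open>s\<^bsup>2k\<^esup>\<close> in closed form.\<close>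

definition moment :: "nat \<Rightarrow> real" where
  "moment k = 2 * (1 / (2 * real k + 1) - 11/50 / (2 * real k + 3) + 1/40 / (2 * real k + 5))"

lemma continuous_weight [continuous_intros]:
  "continuous_on S f \<Longrightarrow> continuous_on S (\<lambda>x. weight (f x))"
  unfolding weight_def by (intro continuous_intros)

text \<open>With \<open>y = s\<^sup>2\<close> the weight is \<open>1 - 0.22 y + 0.025 y\<^sup>2\<close>, which decreases on \<open>[0, 1]\<close>.\<close>

lemma weight_bounds:
  assumes "\<bar>s\<bar> \<le> 1"
  shows "161/200 \<le> weight s" "weight s \<le> 1"
proof -
  have s: "0 \<le> s\<^sup>2" "s\<^sup>2 \<le> 1" using assms by (auto simp: abs_square_le_1)
  have eq: "weight s = 1 - 11/50 * s\<^sup>2 + 1/40 * (s\<^sup>2)\<^sup>2" by (simp add: weight_def)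
  have "(s\<^sup>2)\<^sup>2 \<le> s\<^sup>2" using s by (simp add: power2_eq_square mult_left_le)
  then show "weight s \<le> 1" unfolding eq using s by linarith
  have "0 \<le> (1 - s\<^sup>2)\<^sup>2" by simp
  then have "2 * s\<^sup>2 - 1 \<le> (s\<^sup>2)\<^sup>2" by (simp add: power2_eq_square algebra_simps)
  then show "161/200 \<le> weight s" unfolding eq using s by linarith
qed

lemma set_integral_FTC:
  fixes g :: "real \<Rightarrow> real"
  assumes "\<And>x. (G has_real_derivative g x) (at x)" "continuous_on UNIV g"
  shows "(LINT s:{-1..1}|lborel. g s) = G 1 - G (-1)"
proof -
  have "(LINT s|lborel. g s * indicator {-1..1} s) = G 1 - G (-1)"
    using assms by (intro integral_FTC_Icc_real) (auto simp: continuous_on_eq_continuous_at)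
  then show ?thesis by (simp add: set_lebesgue_integral_def mult.commute)
qed

lemma set_integrable_continuous:
  fixes g :: "real \<Rightarrow> real"
  assumes "continuous_on UNIV g"
  shows "set_integrable lborel {-1..1} g"
  by (rule borel_integrable_atLeastAtMost') (rule continuous_on_subset[OF assms], simp)

lemma wint_power: "wint (\<lambda>s. s ^ (2 * k)) = moment k"
proof -
  define G where "G s = s ^ (2 * k + 1) / (2 * real k + 1) - 11/50 * (s ^ (2 * k + 3) / (2 * real k + 3))
      + 1/40 * (s ^ (2 * k + 5) / (2 * real k + 5))" for s :: real
  have "wint (\<lambda>s. s ^ (2 * k)) = G 1 - G (-1)"
    unfolding wint_def
  proof (rule set_integral_FTC)
    fix s :: real
    have p: "((\<lambda>s. s ^ n / c) has_real_derivative (real n * s ^ (n - 1) / c)) (at s)" for n and c :: real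
      using DERIV_cdivide[OF DERIV_pow[of n s UNIV], of c] by simp
    have "2 * k + 1 - 1 = 2 * k" "2 * k + 3 - 1 = 2 * k + 2" "2 * k + 5 - 1 = 2 * k + 4" by simp_all
    note * = p[of "2 * k + 1" "2 * real k + 1", unfolded this] p[of "2 * k + 3" "2 * real k + 3", unfolded this]
      p[of "2 * k + 5" "2 * real k + 5", unfolded this]
    have "(G has_real_derivative (real (2 * k + 1) * s ^ (2 * k) / (2 * real k + 1)
        - 11/50 * (real (2 * k + 3) * s ^ (2 * k + 2) / (2 * real k + 3))
        + 1/40 * (real (2 * k + 5) * s ^ (2 * k + 4) / (2 * real k + 5)))) (at s)"
      unfolding G_def by (intro DERIV_add DERIV_diff DERIV_cmult *)
    moreover have "real (2 * k + 1) * s ^ (2 * k) / (2 * real k + 1) = s ^ (2 * k)"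
      "real (2 * k + 3) * s ^ (2 * k + 2) / (2 * real k + 3) = s ^ (2 * k) * s ^ 2"
      "real (2 * k + 5) * s ^ (2 * k + 4) / (2 * real k + 5) = s ^ (2 * k) * s ^ 4"
    proof -
      have q: "c * p / c = p" if "c > 0" for c p :: real using that by simp
      have r: "real (2 * k + 1) = 2 * real k + 1" "real (2 * k + 3) = 2 * real k + 3"
        "real (2 * k + 5) = 2 * real k + 5" by simp_all
      show "real (2 * k + 1) * s ^ (2 * k) / (2 * real k + 1) = s ^ (2 * k)"
        "real (2 * k + 3) * s ^ (2 * k + 2) / (2 * real k + 3) = s ^ (2 * k) * s ^ 2"
        "real (2 * k + 5) * s ^ (2 * k + 4) / (2 * real k + 5) = s ^ (2 * k) * s ^ 4"
        unfolding r power_add by (rule q, simp)+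
    qed
    moreover have "weight s * s ^ (2 * k)
        = s ^ (2 * k) - 11/50 * (s ^ (2 * k) * s ^ 2) + 1/40 * (s ^ (2 * k) * s ^ 4)"
      unfolding weight_def by algebra
    ultimately show "(G has_real_derivative weight s * s ^ (2 * k)) (at s)"
      by (simp only:)
  qed (intro continuous_intros)
  also have "\<dots> = moment k"
    by (simp add: G_def moment_def power_add)
  finally show ?thesis .
qed

lemma wint_add:
  assumes "continuous_on UNIV f" "continuous_on UNIV g"
  shows "wint (\<lambda>s. f s + g s) = wint f + wint g"
  unfolding wint_def distrib_left
  by (intro set_integral_add set_integrable_continuous continuous_intros assms)

lemma wint_diff:
  assumes "continuous_on UNIV f" "continuous_on UNIV g"
  shows "wint (\<lambda>s. f s - g s) = wint f - wint g"
  unfolding wint_def right_diff_distrib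
  by (intro set_integral_diff set_integrable_continuous continuous_intros assms)

lemma wint_cmult: "wint (\<lambda>s. c * f s) = c * wint f"
  unfolding wint_def by (simp add: mult.left_commute)

lemma wint_sum:
  assumes "finite K"
  shows "wint (\<lambda>s. \<Sum>k\<in>K. c k * s ^ (2 * k)) = (\<Sum>k\<in>K. c k * moment k)"
  using assms
proof (induction K rule: finite_induct)
  case empty
  show ?case by (simp add: wint_def)
next
  case (insert k K)
  have "wint (\<lambda>s. \<Sum>k\<in>insert k K. c k * s ^ (2 * k))
      = wint (\<lambda>s. c k * s ^ (2 * k) + (\<Sum>k\<in>K. c k * s ^ (2 * k)))"
    using insert by simp
  also have "\<dots> = wint (\<lambda>s. c k * s ^ (2 * k)) + wint (\<lambda>s. \<Sum>k\<in>K. c k * s ^ (2 * k))"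
    by (intro wint_add continuous_intros)
  finally show ?case
    using insert by (simp add: wint_cmult wint_power)
qed

lemma wint_mono:
  assumes "continuous_on UNIV f" "continuous_on UNIV g" "\<And>s. \<bar>s\<bar> \<le> 1 \<Longrightarrow> f s \<le> g s"
  shows "wint f \<le> wint g"
  unfolding wint_def
proof (rule set_integral_mono)
  fix s :: real assume "s \<in> {-1..1}"
  then have "\<bar>s\<bar> \<le> 1" by auto
  then show "weight s * f s \<le> weight s * g s"
    using weight_bounds[of s] assms(3)[of s] by (intro mult_left_mono) auto
qed (intro set_integrable_continuous continuous_intros assms)+

text \<open>Passing to a nonnegative majorant removes the unknown set \<open>N\<close>.\<close>

lemma set_integral_le_wint:
  assumes "continuous_on UNIV f" "continuous_on UNIV M"
    and N: "N \<in> sets borel" "N \<subseteq> {-1..1}"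
    and "\<And>s. \<bar>s\<bar> \<le> 1 \<Longrightarrow> f s \<le> M s" "\<And>s. \<bar>s\<bar> \<le> 1 \<Longrightarrow> 0 \<le> M s"
  shows "(LINT s:N|lborel. weight s * f s) \<le> wint M"
  unfolding wint_def set_lebesgue_integral_def
proof (rule integral_mono)
  have "set_integrable lborel {-1..1} (\<lambda>s. weight s * f s)" "set_integrable lborel {-1..1} (\<lambda>s. weight s * M s)"
    by (intro set_integrable_continuous continuous_intros assms)+
  then show "integrable lborel (\<lambda>s. indicat_real {-1..1} s *\<^sub>R (weight s * M s))"
    and "integrable lborel (\<lambda>s. indicat_real N s *\<^sub>R (weight s * f s))"
    using set_integrable_subset[of lborel "{-1..1}" "\<lambda>s. weight s * f s" N] N by (auto simp: set_integrable_def)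
  fix s :: real
  have "0 \<le> weight s * M s" "weight s * f s \<le> weight s * M s" if "\<bar>s\<bar> \<le> 1"
    using weight_bounds[OF that] assms(5,6)[OF that] by (auto intro!: mult_left_mono mult_nonneg_nonneg)
  then show "indicat_real N s *\<^sub>R (weight s * f s) \<le> indicat_real {-1..1} s *\<^sub>R (weight s * M s)"
    using N(2) by (auto simp: indicator_def abs_le_iff)
qed

section \<open>Weighted integrals of cosines\<close>

lemma pi_bounds: "31415/10000 \<le> pi" "pi \<le> 31416/10000"
  using pi_approx by simp_all

text \<open>\<open>2 \<pi> a b\<close> for \<open>a b = 0.2025\<close>: the frequency that appears when both variables are rescaled to
  \<open>[-1, 1]\<close>.\<close>

definition theta :: real where "theta = 81/200 * pi"

lemma theta_bounds: "1.2723 \<le> theta" "theta \<le> 1.27235" "1.6188 \<le> theta\<^sup>2" "theta\<^sup>2 \<le> 1.6189"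
proof -
  show l: "1.2723 \<le> theta" and u: "theta \<le> 1.27235"
    unfolding theta_def using pi_approx by auto
  have "1.27234 \<le> theta" unfolding theta_def using pi_approx by auto
  then have "1.27234\<^sup>2 \<le> theta\<^sup>2" by (intro power_mono) auto
  then show "1.6188 \<le> theta\<^sup>2" by (simp add: power2_eq_square)
  have "theta\<^sup>2 \<le> 1.27235\<^sup>2" using l u by (intro power_mono) auto
  then show "theta\<^sup>2 \<le> 1.6189" by (simp add: power2_eq_square)
qed

lemma cos_maclaurin_even:
  obtains c :: real where "\<bar>c\<bar> \<le> 1"
    "cos v = (\<Sum>k<n. (- 1) ^ k / fact (2 * k) * v ^ (2 * k)) + c / fact (2 * n) * v ^ (2 * n)"
proof -
  obtain t where "cos v = (\<Sum>m<2 * n. cos_coeff m * v ^ m) + (cos (t + 1/2 * real (2 * n) * pi) / fact (2 * n)) * v ^ (2 * n)"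
    using Maclaurin_cos_expansion[of v "2 * n"] by blast
  moreover have "(\<Sum>m<2 * n. cos_coeff m * v ^ m) = (\<Sum>k<n. (- 1) ^ k / fact (2 * k) * v ^ (2 * k))"
    by (induction n) (simp_all add: cos_coeff_def)
  ultimately show ?thesis
    using that[of "cos (t + 1/2 * real (2 * n) * pi)"] abs_cos_le_one by auto
qed

lemma cos_upper_4: "cos v \<le> 1 - v\<^sup>2 / 2 + v ^ 4 / 24" for v :: real
proof -
  obtain c :: real where c: "\<bar>c\<bar> \<le> 1"
    and eq: "cos v = (\<Sum>k<2. (- 1) ^ k / fact (2 * k) * v ^ (2 * k)) + c / fact (2 * 2) * v ^ (2 * 2)"
    by (rule cos_maclaurin_even)
  have "c * v ^ 4 \<le> 1 * v ^ 4" using c by (intro mult_right_mono) auto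
  moreover have "cos v = 1 - v\<^sup>2 / 2 + c * v ^ 4 / 24"
    unfolding eq by (simp add: lessThan_nat_numeral fact_numeral)
  ultimately show ?thesis by simp
qed

lemma cos_lower_6: "1 - v\<^sup>2 / 2 + v ^ 4 / 24 - v ^ 6 / 720 \<le> cos v" for v :: real
proof -
  obtain c :: real where c: "\<bar>c\<bar> \<le> 1"
    and eq: "cos v = (\<Sum>k<3. (- 1) ^ k / fact (2 * k) * v ^ (2 * k)) + c / fact (2 * 3) * v ^ (2 * 3)"
    by (rule cos_maclaurin_even)
  have "(-1) * v ^ 6 \<le> c * v ^ 6" using c by (intro mult_right_mono) auto
  moreover have "cos v = 1 - v\<^sup>2 / 2 + v ^ 4 / 24 + c * v ^ 6 / 720"
    unfolding eq by (simp add: lessThan_nat_numeral fact_numeral)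
  ultimately show ?thesis by simp
qed

text \<open>The Taylor coefficients up to degree 18; the entry for degree 20 is the worst case of the
  remainder.\<close>

definition cos_taylor_coeff :: "nat \<Rightarrow> real" where
  "cos_taylor_coeff k = (if k = 10 then - 1 / fact 20 else (- 1) ^ k / fact (2 * k))"

lemma cos_lower_20: "(\<Sum>k<11. cos_taylor_coeff k * v ^ (2 * k)) \<le> cos v" for v :: real
proof -
  obtain c :: real where c: "\<bar>c\<bar> \<le> 1"
    and eq: "cos v = (\<Sum>k<10. (- 1) ^ k / fact (2 * k) * v ^ (2 * k)) + c / fact (2 * 10) * v ^ (2 * 10)"
    by (rule cos_maclaurin_even)
  have "(-1) / fact 20 * v ^ 20 \<le> c / fact 20 * v ^ 20"
    using c by (intro mult_right_mono divide_right_mono) auto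
  moreover have "(\<Sum>k<10. (- 1) ^ k / fact (2 * k) * v ^ (2 * k)) = (\<Sum>k<10. cos_taylor_coeff k * v ^ (2 * k))"
    by (intro sum.cong) (auto simp: cos_taylor_coeff_def)
  moreover have "(\<Sum>k<Suc 10. cos_taylor_coeff k * v ^ (2 * k))
      = (\<Sum>k<10. cos_taylor_coeff k * v ^ (2 * k)) + (-1) / fact 20 * v ^ 20"
    by (subst sum.lessThan_Suc) (simp add: cos_taylor_coeff_def)
  ultimately show ?thesis
    unfolding eq by simp
qed

lemma wint_cos_lower:
  "poly_list cos_poly (u\<^sup>2 / 40) - 159/1000 \<le> 9/20 * wint (\<lambda>s. cos (u * s))"
proof -
  define z where "z = u\<^sup>2 / 40"
  have z: "z = u\<^sup>2 / 40" "0 \<le> z" by (simp_all add: z_def)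
  have "poly_list cos_poly z - 159/1000 \<le> 9/20 * (\<Sum>k<11. (cos_taylor_coeff k * u ^ (2 * k)) * moment k)"
  proof -
    have coeff: "poly_list cos_poly z - 159/1000 = (\<Sum>k<11. (if k = 0 then 8385/10000 else cos_poly ! k) * z ^ k)"
      by (simp add: cos_poly_def lessThan_nat_numeral) (simp add: eval_nat_numeral algebra_simps)
    have le: "(if k = 0 then 8385/10000 else cos_poly ! k) \<le> 9/20 * cos_taylor_coeff k * 40 ^ k * moment k"
      if "k < 11" for k
    proof -
      have "k = 0 \<or> k = 1 \<or> k = 2 \<or> k = 3 \<or> k = 4 \<or> k = 5 \<or> k = 6 \<or> k = 7
          \<or> k = 8 \<or> k = 9 \<or> k = 10"
        using that by presburger
      then show ?thesis
        by (elim disjE) (simp_all add: cos_poly_def cos_taylor_coeff_def moment_def fact_numeral)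
    qed
    have "(if k = 0 then 8385/10000 else cos_poly ! k) * z ^ k
        \<le> 9/20 * ((cos_taylor_coeff k * u ^ (2 * k)) * moment k)" if "k < 11" for k
    proof -
      have "(if k = 0 then 8385/10000 else cos_poly ! k) * z ^ k \<le> (9/20 * cos_taylor_coeff k * 40 ^ k * moment k) * z ^ k"
        using le[OF that] z by (intro mult_right_mono) auto
      also have "\<dots> = 9/20 * ((cos_taylor_coeff k * u ^ (2 * k)) * moment k)"
        by (simp add: z power_mult power_divide)
      finally show ?thesis .
    qed
    then show ?thesis
      unfolding coeff sum_distrib_left by (intro sum_mono) auto
  qed
  also have "(\<Sum>k<11. (cos_taylor_coeff k * u ^ (2 * k)) * moment k)
      = wint (\<lambda>s. \<Sum>k<11. (cos_taylor_coeff k * u ^ (2 * k)) * s ^ (2 * k))"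
    by (rule wint_sum[symmetric]) simp
  also have "9/20 * \<dots> \<le> 9/20 * wint (\<lambda>s. cos (u * s))"
  proof (intro mult_left_mono wint_mono)
    fix s :: real
    show "(\<Sum>k<11. (cos_taylor_coeff k * u ^ (2 * k)) * s ^ (2 * k)) \<le> cos (u * s)"
      using cos_lower_20[of "u * s"] by (simp add: power_mult_distrib mult.assoc)
  qed (auto intro!: continuous_intros)
  finally show ?thesis by (simp add: z)
qed

text \<open>Both sides are quadratic in \<open>X = x\<^sup>2\<close>, and the fourth-order Taylor polynomial suffices because
  \<open>\<theta>\<close> is small. The difference is smallest near \<open>X = 0.41\<close>, where only \<open>0.00015\<close> is left: the
  weight is tuned so that the two sides nearly agree.\<close>

lemma wint_cos_upper:
  assumes "\<bar>x\<bar> \<le> 1"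
  shows "9/20 * wint (\<lambda>s. 1 - (theta * x * s)\<^sup>2 / 2 + (theta * x * s) ^ 4 / 24) \<le> weight x - 4/25"
proof -
  define c where "c k = (if k = 0 then 1 else if k = 1 then - (theta * x)\<^sup>2 / 2 else (theta * x) ^ 4 / 24)" for k :: nat
  have "(\<lambda>s. 1 - (theta * x * s)\<^sup>2 / 2 + (theta * x * s) ^ 4 / 24) = (\<lambda>s. \<Sum>k<3. c k * s ^ (2 * k))"
    by (simp add: c_def lessThan_nat_numeral power_mult_distrib fun_eq_iff)
  then have "wint (\<lambda>s. 1 - (theta * x * s)\<^sup>2 / 2 + (theta * x * s) ^ 4 / 24) = (\<Sum>k<3. c k * moment k)"
    by (simp only: wint_sum[OF finite_lessThan])
  also have "\<dots> = moment 0 - theta\<^sup>2 * x\<^sup>2 / 2 * moment 1 + (theta\<^sup>2)\<^sup>2 * (x\<^sup>2)\<^sup>2 / 24 * moment 2"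
    by (simp add: c_def lessThan_nat_numeral power_mult_distrib)
  finally have eq: "wint (\<lambda>s. 1 - (theta * x * s)\<^sup>2 / 2 + (theta * x * s) ^ 4 / 24)
     = moment 0 - theta\<^sup>2 * x\<^sup>2 / 2 * moment 1 + (theta\<^sup>2)\<^sup>2 * (x\<^sup>2)\<^sup>2 / 24 * moment 2" .
  define X where "X = x\<^sup>2"
  have X: "0 \<le> X" "X \<le> 1" using assms by (auto simp: X_def abs_square_le_1)
  have "(theta\<^sup>2)\<^sup>2 \<le> 1.6189\<^sup>2" using theta_bounds by (intro power_mono) auto
  then have t4: "(theta\<^sup>2)\<^sup>2 \<le> 2.6209" by (simp add: power2_eq_square)
  have "moment 0 - theta\<^sup>2 * X / 2 * moment 1 + (theta\<^sup>2)\<^sup>2 * X\<^sup>2 / 24 * moment 2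
      \<le> moment 0 - 4047/2500 * X / 2 * moment 1 + 26209/10000 * X\<^sup>2 / 24 * moment 2"
    using X t4 theta_bounds
    by (intro add_mono diff_left_mono mult_right_mono divide_right_mono mult_mono) (auto simp: moment_def)
  also have "9/20 * \<dots> \<le> 1 - 11/50 * X + 1/40 * X\<^sup>2 - 4/25"
  proof -
    have m: "moment 0 = 559/300" "moment 1 = 6151/10500" "moment 2 = 2159/6300"
      by (simp_all add: moment_def)
    have "0 \<le> (X - 41/100)\<^sup>2" by simp
    then have "82/100 * X \<le> X\<^sup>2 + 1681/10000" by (simp add: power2_eq_square algebra_simps)
    moreover define Y where "Y = X\<^sup>2"
    ultimately have "82/100 * X \<le> Y + 1681/10000" "0 \<le> Y" by simp_all
    then show ?thesis
      unfolding m Y_def[symmetric] by (simp add: field_simps)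
  qed
  also have "1 - 11/50 * X + 1/40 * X\<^sup>2 - 4/25 = weight x - 4/25"
    by (simp add: weight_def X_def)
  finally show ?thesis unfolding eq X_def by simp
qed


text \<open>Stated for all \<open>v\<close> up to \<open>\<theta> \<bar>s\<bar>\<close>, so that it covers \<open>\<theta> x s\<close> for every \<open>x\<close> in \<open>[-1, 1]\<close> as well as
  \<open>u s\<close> for small \<open>u\<close>.\<close>

lemma one_minus_cos_theta_le:
  assumes "\<bar>s\<bar> \<le> 1" "\<bar>v\<bar> \<le> theta * \<bar>s\<bar>"
  shows "1 - cos v \<le> 8095/10000 * s\<^sup>2 - 1032/10000 * s ^ 4"
proof -
  have th: "0 < theta" "theta \<le> pi" using theta_bounds pi_bounds by auto
  have "\<bar>v\<bar> \<le> pi" "theta * \<bar>s\<bar> \<le> pi" using assms th by (smt (verit) mult_left_le)+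
  then have "cos (theta * \<bar>s\<bar>) \<le> cos \<bar>v\<bar>"
    using assms by (intro cos_monotone_0_pi_le) auto
  then have "1 - cos v \<le> 1 - cos (theta * \<bar>s\<bar>)" by simp
  also have "\<dots> \<le> (theta * \<bar>s\<bar>)\<^sup>2 / 2 - (theta * \<bar>s\<bar>) ^ 4 / 24 + (theta * \<bar>s\<bar>) ^ 6 / 720"
    using cos_lower_6[of "theta * \<bar>s\<bar>"] by simp
  also have "\<dots> = theta\<^sup>2 / 2 * s\<^sup>2 - (theta\<^sup>2)\<^sup>2 / 24 * s ^ 4 + (theta\<^sup>2) ^ 3 / 720 * (s ^ 4 * s\<^sup>2)"
    by (simp add: power_mult_distrib power_even_abs flip: power_mult power_add)
  also have "\<dots> \<le> 8095/10000 * s\<^sup>2 - 26205/240000 * s ^ 4 + 42430/7200000 * (s ^ 4 * 1)"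
  proof -
    have "1.6188\<^sup>2 \<le> (theta\<^sup>2)\<^sup>2" "(theta\<^sup>2) ^ 3 \<le> 1.6189 ^ 3"
      using theta_bounds by (intro power_mono; simp)+
    then have "26205/10000 \<le> (theta\<^sup>2)\<^sup>2" "(theta\<^sup>2) ^ 3 \<le> 42430/10000"
      by (simp_all add: eval_nat_numeral)
    moreover have "s\<^sup>2 \<le> 1" using assms by (simp add: abs_square_le_1)
    ultimately show ?thesis
      using theta_bounds
      by (intro add_mono diff_mono mult_mono mult_right_mono mult_left_mono) auto
  qed
  also have "\<dots> \<le> 8095/10000 * s\<^sup>2 - 1032/10000 * s ^ 4"
    using zero_le_even_power[of 4 s] by simp
  finally show ?thesis .
qed

text \<open>A lower bound of \<open>(1 + cos(\<theta> s)) / 2\<close>, the factor that damps \<open>cos(u s)\<close> for large \<open>u\<close>.\<close>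

definition cos_minorant :: "real \<Rightarrow> real" where
  "cos_minorant s = 1 - 8095/20000 * s\<^sup>2 + 1032/20000 * s ^ 4"

text \<open>Integration by parts twice, with \<open>q\<close> the product of weight and minorant: the boundary terms are
  \<open>2 (q(1) sin u / u + q'(1) cos u / u\<^sup>2)\<close> and the remaining integral is \<open>O(1 / u\<^sup>2)\<close>. The sine is
  nearly nonnegative up to \<open>3 \<pi>\<close> and not far below 0 up to 10; beyond 10 the factor \<open>1 / u\<close> is small
  enough, provided that sine and cosine are estimated jointly by Cauchy--Schwarz.\<close>

lemma wint_cos_minorant_cos:
  assumes u: "31/5 \<le> u"
  shows "- 6025/100000 \<le> 9/20 * wint (\<lambda>s. cos_minorant s * cos (u * s))"
proof -
  define q where "q s = weight s * cos_minorant s" for s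
  define q1 where "q1 s = - 12495/10000 * s + 66258/100000 * s ^ 3 - 1288245/10000000 * s ^ 5
      + 1032/100000 * s ^ 7" for s :: real
  define q2 where "q2 s = - 12495/10000 + 198774/100000 * s\<^sup>2 - 6441225/10000000 * s ^ 4
      + 7224/100000 * s ^ 6" for s :: real
  have dq: "(q has_real_derivative q1 s) (at s)" for s
    unfolding q_def weight_def cos_minorant_def q1_def
    by (auto intro!: derivative_eq_intros simp: eval_nat_numeral field_simps)
  have dq1: "(q1 has_real_derivative q2 s) (at s)" for s
    unfolding q1_def q2_def
    by (auto intro!: derivative_eq_intros simp: eval_nat_numeral field_simps)
  define G where "G s = q s * sin (u * s) / u + q1 s * cos (u * s) / u\<^sup>2" for s
  have dG: "(G has_real_derivative (q s * cos (u * s) + q2 s * cos (u * s) / u\<^sup>2)) (at s)" for s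
    unfolding G_def using u
    by (auto intro!: derivative_eq_intros dq dq1 simp: field_simps power2_eq_square)
  have cq: "continuous_on UNIV q" "continuous_on UNIV q2"
    unfolding q_def q2_def weight_def cos_minorant_def by (intro continuous_intros)+
  have int: "set_integrable lborel {-1..1} (\<lambda>s. q s * cos (u * s))"
    "set_integrable lborel {-1..1} (\<lambda>s. q2 s * cos (u * s) / u\<^sup>2)"
    using cq u by (intro set_integrable_continuous continuous_intros; simp)+
  have "(LINT s:{-1..1}|lborel. q s * cos (u * s)) + (LINT s:{-1..1}|lborel. q2 s * cos (u * s) / u\<^sup>2)
      = (LINT s:{-1..1}|lborel. q s * cos (u * s) + q2 s * cos (u * s) / u\<^sup>2)"
    by (rule set_integral_add(2)[symmetric, OF int])
  also have "\<dots> = G 1 - G (-1)"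
    using cq u by (intro set_integral_FTC dG continuous_intros) auto
  also have "\<dots> = 2 * (q 1 * sin u / u + q1 1 * cos u / u\<^sup>2)"
    by (simp add: G_def q_def q1_def weight_def cos_minorant_def)
  finally have parts: "wint (\<lambda>s. cos_minorant s * cos (u * s))
      = 2 * (q 1 * sin u / u + q1 1 * cos u / u\<^sup>2) - (LINT s:{-1..1}|lborel. q2 s * cos (u * s) / u\<^sup>2)"
    by (simp add: wint_def q_def mult_ac)
  have "(LINT s:{-1..1}|lborel. q2 s * cos (u * s) / u\<^sup>2) \<le> (LINT s:{-1..1::real}|lborel. 5/4 / u\<^sup>2)"
  proof (rule set_integral_mono[OF int(2)])
    show "set_integrable lborel {-1..1::real} (\<lambda>s. 5/4 / u\<^sup>2)"
      by (intro set_integrable_continuous continuous_intros)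
    fix s :: real assume "s \<in> {-1..1}"
    then have s: "0 \<le> s\<^sup>2" "s\<^sup>2 \<le> 1" by (auto simp: abs_square_le_1)
    have "\<bar>q2 s\<bar> \<le> 5/4"
    proof -
      have eq: "q2 s = - 12495/10000 + 198774/100000 * s\<^sup>2 - 6441225/10000000 * (s\<^sup>2 * s\<^sup>2)
        + 7224/100000 * ((s\<^sup>2 * s\<^sup>2) * s\<^sup>2)"
        by (simp add: q2_def flip: power_add)
      have "y * y \<le> y" "(y * y) * y \<le> y * y" if "0 \<le> y" "y \<le> 1" for y :: real
        using that by (auto intro!: mult_left_le)
      from this[OF s] have "s\<^sup>2 * s\<^sup>2 \<le> s\<^sup>2" "(s\<^sup>2 * s\<^sup>2) * s\<^sup>2 \<le> s\<^sup>2 * s\<^sup>2" .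
      moreover have "0 \<le> s\<^sup>2 * s\<^sup>2" "0 \<le> (s\<^sup>2 * s\<^sup>2) * s\<^sup>2" by simp_all
      ultimately show ?thesis unfolding eq abs_le_iff using s by linarith
    qed
    then have "\<bar>q2 s * cos (u * s)\<bar> \<le> 5/4"
      by (simp add: abs_mult) (smt (verit) abs_cos_le_one mult_left_le abs_ge_zero)
    then show "q2 s * cos (u * s) / u\<^sup>2 \<le> 5/4 / u\<^sup>2"
      by (intro divide_right_mono) auto
  qed
  also have "\<dots> = 5/2 / u\<^sup>2"
    by (simp add: set_lebesgue_integral_def)
  finally have rem: "(LINT s:{-1..1}|lborel. q2 s * cos (u * s) / u\<^sup>2) \<le> 5/2 / u\<^sup>2" .
  have double: "5/2 / u\<^sup>2 = 2 * (5/4 / u\<^sup>2)" by simp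
  have q: "q 1 = 52071425/100000000" "q1 1 = - 7054245/10000000"
    by (simp_all add: q_def q1_def weight_def cos_minorant_def)
  have "- 6694/100000 * u\<^sup>2 \<le> q 1 * sin u * u + q1 1 * cos u - 5/4"
  proof -
    have R: "- 70543/100000 \<le> q1 1 * cos u"
      using cos_le_one[of u] unfolding q by linarith
    consider "u \<le> 3 * pi" | "3 * pi \<le> u" "u \<le> 10" | "10 \<le> u" by linarith
    then show ?thesis
    proof cases
      case 1
      have "- 84/1000 \<le> sin u"
      proof (cases "u \<le> 2 * pi")
        case True
        have "sin u = - sin (2 * pi - u)" by (simp add: sin_diff)
        moreover have "sin (2 * pi - u) \<le> 2 * pi - u" using True by (intro sin_x_le_x) auto
        ultimately show ?thesis using u pi_bounds by linarith
      next
        case False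
        have "sin u = sin (u - 2 * pi)" by (simp add: sin_diff)
        moreover have "0 \<le> sin (u - 2 * pi)" using False 1 by (intro sin_ge_zero) auto
        ultimately show ?thesis by linarith
      qed
      then have "(- 84/1000) * u \<le> sin u * u" using u by (intro mult_right_mono) auto
      moreover have "31/5 * u \<le> u\<^sup>2" using u by (simp add: power2_eq_square)
      ultimately show ?thesis using R u unfolding q by linarith
    next
      case 2
      have "sin u = - sin (u - 3 * pi)"
        using sin_3over2_pi by (simp add: sin_diff)
      moreover have "sin (u - 3 * pi) \<le> u - 3 * pi" using 2 by (intro sin_x_le_x) auto
      ultimately have "- 58/100 \<le> sin u" using 2 pi_bounds by linarith
      then have "(- 58/100) * u \<le> sin u * u" using u by (intro mult_right_mono) auto
      moreover have "942/100 \<le> u" using 2 pi_bounds by linarith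
      moreover from this have "942/100 * u \<le> u\<^sup>2" by (simp add: power2_eq_square)
      ultimately show ?thesis using R unfolding q by linarith
    next
      case 3
      have "(a * p + r * c)\<^sup>2 = (a\<^sup>2 + r\<^sup>2) * (p\<^sup>2 + c\<^sup>2) - (a * c - r * p)\<^sup>2" for a p r c :: real
        by (simp add: power2_eq_square algebra_simps)
      then have "(q 1 * u * sin u + q1 1 * cos u)\<^sup>2
          = ((q 1 * u)\<^sup>2 + (q1 1)\<^sup>2) * ((sin u)\<^sup>2 + (cos u)\<^sup>2) - (q 1 * u * cos u - q1 1 * sin u)\<^sup>2"
        by blast
      also have "\<dots> \<le> (q 1 * u)\<^sup>2 + (q1 1)\<^sup>2"
        by simp
      also have "\<dots> \<le> (526/1000 * u)\<^sup>2"
      proof -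
        have "10 * 10 \<le> u\<^sup>2" unfolding power2_eq_square using 3 by (intro mult_mono) auto
        then show ?thesis unfolding q by (simp add: power_mult_distrib power_divide)
      qed
      finally have "\<bar>q 1 * u * sin u + q1 1 * cos u\<bar> \<le> \<bar>526/1000 * u\<bar>"
        by (simp only: abs_le_square_iff)
      moreover have "\<bar>526/1000 * u\<bar> = 526/1000 * u" "q 1 * u * sin u = q 1 * sin u * u"
        using 3 by simp_all
      ultimately have "- (526/1000 * u) \<le> q 1 * sin u * u + q1 1 * cos u"
        by linarith
      moreover have "10 * u \<le> u\<^sup>2" using 3 by (simp add: power2_eq_square)
      ultimately show ?thesis using 3 by linarith
    qed
  qed
  then have "- 6694/100000 \<le> (q 1 * sin u * u + q1 1 * cos u - 5/4) / u\<^sup>2"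
    using u by (simp add: pos_le_divide_eq)
  also have "\<dots> = q 1 * sin u / u + q1 1 * cos u / u\<^sup>2 - 5/4 / u\<^sup>2"
    using u by (simp add: diff_divide_distrib add_divide_distrib power2_eq_square)
  finally have main: "- 6694/100000 \<le> q 1 * sin u / u + q1 1 * cos u / u\<^sup>2 - 5/4 / u\<^sup>2" .
  have "- 6025/100000 \<le> 9/20 * (2 * (a + b) - d)"
    if "- 6694/100000 \<le> a + b - c" "d \<le> c'" "c' = 2 * c" for a b c c' d :: real
    using that by (simp add: field_simps)
  from this[OF main rem double] show ?thesis unfolding parts .
qed


text \<open>The limiting case of the theorem below in which \<open>u\<close> tends to infinity and the oscillating term
  disappears.\<close>

lemma weighted_cos_bound:
  assumes N: "N \<in> sets borel" "N \<subseteq> {-1..1}" and x: "\<bar>x\<bar> \<le> 1"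
  shows "9/20 * (LINT s:N|lborel. weight s * cos (theta * x * s)) \<le> weight x - 1/1000"
proof -
  have "(LINT s:N|lborel. weight s * cos (theta * x * s))
      \<le> wint (\<lambda>s. 1 - (theta * x * s)\<^sup>2 / 2 + (theta * x * s) ^ 4 / 24)"
  proof (rule set_integral_le_wint[OF _ _ N])
    fix s :: real assume s: "\<bar>s\<bar> \<le> 1"
    show "cos (theta * x * s) \<le> 1 - (theta * x * s)\<^sup>2 / 2 + (theta * x * s) ^ 4 / 24"
      by (rule cos_upper_4)
    have "(x * s)\<^sup>2 \<le> 1"
      using x s by (simp add: power_mult_distrib abs_square_le_1 mult_le_one)
    then have "theta\<^sup>2 * (x * s)\<^sup>2 \<le> 1.6189 * 1" using theta_bounds by (intro mult_mono) auto
    then have "(theta * x * s)\<^sup>2 \<le> 2" by (simp add: power_mult_distrib mult.assoc)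
    moreover have "0 \<le> (theta * x * s) ^ 4" by simp
    ultimately show "0 \<le> 1 - (theta * x * s)\<^sup>2 / 2 + (theta * x * s) ^ 4 / 24"
      by linarith
  qed (auto intro!: continuous_intros)
  then show ?thesis using wint_cos_upper[OF x] by linarith
qed

text \<open>The positive part of \<open>cos(\<theta> x s) - cos(u s)\<close> is at most
  \<open>cos(\<theta> x s) - cos(u s) + l(s)\<close> for any \<open>l\<close> that bounds the opposite difference. The point \<open>x\<close> is
  then separated from \<open>u\<close>: the first summand is treated by \<open>wint_cos_upper\<close>, which gains \<open>0.16\<close>, and
  the other two may cost \<open>0.159\<close>.\<close>

lemma weighted_cos_diff_le_wint:
  assumes N: "N \<in> sets borel" "N \<subseteq> {-1..1}" and x: "\<bar>x\<bar> \<le> 1"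
    and l: "continuous_on UNIV l"
      "\<And>s. \<bar>s\<bar> \<le> 1 \<Longrightarrow> 0 \<le> l s" "\<And>s. \<bar>s\<bar> \<le> 1 \<Longrightarrow> cos (u * s) - cos (theta * x * s) \<le> l s"
    and C: "9/20 * wint (\<lambda>s. l s - cos (u * s)) \<le> 159/1000"
  shows "9/20 * (LINT s:N|lborel. weight s * (cos (theta * x * s) - cos (u * s))) \<le> weight x - 1/1000"
proof -
  let ?C = "\<lambda>s. 1 - (theta * x * s)\<^sup>2 / 2 + (theta * x * s) ^ 4 / 24"
  have "(LINT s:N|lborel. weight s * (cos (theta * x * s) - cos (u * s)))
      \<le> wint (\<lambda>s. ?C s + (l s - cos (u * s)))"
  proof (rule set_integral_le_wint[OF _ _ N])
    fix s :: real assume s: "\<bar>s\<bar> \<le> 1"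
    show "cos (theta * x * s) - cos (u * s) \<le> ?C s + (l s - cos (u * s))"
      "0 \<le> ?C s + (l s - cos (u * s))"
      using cos_upper_4[of "theta * x * s"] l(2,3)[OF s] by linarith+
  qed (auto intro!: continuous_intros l)
  also have "\<dots> = wint ?C + wint (\<lambda>s. l s - cos (u * s))"
    by (intro wint_add) (auto intro!: continuous_intros l)
  finally show ?thesis using wint_cos_upper[OF x] C by linarith
qed

lemma abs_cos_diff_le: "\<bar>cos a - cos b\<bar> \<le> \<bar>a - b\<bar>" for a b :: real
proof -
  have "\<bar>cos a - cos b\<bar> = 2 * (\<bar>sin ((a + b) / 2)\<bar> * \<bar>sin ((b - a) / 2)\<bar>)"
    by (simp add: cos_diff_cos abs_mult)
  also have "\<dots> \<le> 2 * (1 * \<bar>(b - a) / 2\<bar>)"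
    by (intro mult_left_mono mult_mono abs_sin_x_le_abs_x) auto
  also have "\<dots> = \<bar>a - b\<bar>" by simp
  finally show ?thesis .
qed

text \<open>The cosine at \<open>u r\<close> exceeds the one at \<open>\<theta> r\<close> only close to the right end, where \<open>u r\<close> passes
  \<open>2 \<pi> - \<theta> r\<close>; there the excess is at most linear in \<open>r\<close>, and Bernoulli's inequality replaces the
  linear function by an even power whose weighted integral is known.\<close>

lemma cos_diff_le_bernoulli:
  assumes u: "5 \<le> u" "u \<le> 31/5" and r: "0 \<le> r" "r \<le> 1"
  shows "cos (u * r) - cos (theta * r) \<le> (u - 5) * r ^ 6"
proof (cases "(u + theta) * r \<le> 2 * pi")
  case True
  have th: "0 < theta" "theta \<le> pi" using theta_bounds pi_bounds by auto
  have 1: "theta * r \<le> u * r" using u r theta_bounds by (intro mult_right_mono) auto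
  have tr: "0 \<le> theta * r" "theta * r \<le> pi" using th r by (auto intro: order_trans[OF mult_left_le])
  have "cos (u * r) \<le> cos (theta * r)"
  proof (cases "u * r \<le> pi")
    case True
    then show ?thesis using 1 tr by (intro cos_monotone_0_pi_le) auto
  next
    case False
    have "cos (u * r) = cos (2 * pi - u * r)" by (simp add: cos_diff)
    also have "\<dots> \<le> cos (theta * r)"
      using False True tr by (intro cos_monotone_0_pi_le) (auto simp: algebra_simps)
    finally show ?thesis .
  qed
  moreover have "0 \<le> (u - 5) * r ^ 6" using u r by auto
  ultimately show ?thesis by linarith
next
  case False
  have "cos (u * r) - cos (theta * r) = cos (2 * pi - u * r) - cos (theta * r)" by (simp add: cos_diff)
  also have "\<dots> \<le> \<bar>(2 * pi - u * r) - theta * r\<bar>"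
    using abs_cos_diff_le[of "2 * pi - u * r" "theta * r"] by linarith
  also have "\<dots> = (u + theta) * r - 2 * pi"
    using False by (simp add: algebra_simps)
  also have "\<dots> \<le> (u - 5) - (u + theta) * (1 - r)"
    using theta_bounds pi_bounds by (simp add: algebra_simps)
  also have "\<dots> \<le> (u - 5) - (6 * (u - 5)) * (1 - r)"
    using u r theta_bounds by (intro diff_left_mono mult_right_mono) auto
  also have "\<dots> = (u - 5) * (1 + real 6 * (r - 1))" by (simp add: algebra_simps)
  also have "\<dots> \<le> (u - 5) * (1 + (r - 1)) ^ 6"
    using u r by (intro mult_left_mono Bernoulli_inequality) auto
  finally show ?thesis by simp
qed

text \<open>The heart of the lower bound. By symmetry \<open>u \<ge> 0\<close>. For \<open>\<theta> \<le> u \<le> 5\<close> the difference of the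
  cosines has a constant sign and nothing is lost in passing to the positive part; this contains the
  critical value \<open>u = 4.6\<close>. Smaller \<open>u\<close> are trivial. From 5 to \<open>6.2\<close> the difference changes sign only
  near the ends of the interval. For larger \<open>u\<close> it does so repeatedly, but there is enough room for
  the bound \<open>(p - q)\<^sup>+ \<le> (1 + p) (1 - q) / 2\<close>, valid for \<open>p\<close> and \<open>q\<close> in \<open>[-1, 1]\<close>.\<close>

theorem weighted_cos_diff_bound:
  assumes N: "N \<in> sets borel" "N \<subseteq> {-1..1}" and x: "\<bar>x\<bar> \<le> 1"
  shows "9/20 * (LINT s:N|lborel. weight s * (cos (theta * x * s) - cos (u * s))) \<le> weight x - 1/1000"
proof -
  have nonneg: "9/20 * (LINT s:N|lborel. weight s * (cos (theta * x * s) - cos (u * s))) \<le> weight x - 1/1000"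
    if u: "0 \<le> u" for u
  proof -
    have th: "0 < theta" "theta \<le> pi" using theta_bounds pi_bounds by auto
    have a: "theta * \<bar>x\<bar> * \<bar>s\<bar> \<le> theta * \<bar>s\<bar>" for s
      using x th mult_right_mono[of "\<bar>x\<bar>" 1 "\<bar>s\<bar>"] by (simp add: mult.assoc)
    have cos_theta: "cos (theta * \<bar>s\<bar>) \<le> cos (theta * x * s)" if "\<bar>s\<bar> \<le> 1" for s
    proof -
      have "cos (theta * \<bar>s\<bar>) \<le> cos (theta * \<bar>x\<bar> * \<bar>s\<bar>)"
        using a th that by (intro cos_monotone_0_pi_le) (auto intro: order_trans[OF mult_left_le])
      also have "\<dots> = cos \<bar>theta * x * s\<bar>" using th by (simp add: abs_mult)
      finally show ?thesis by simp
    qed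
    have cos_abs: "cos (u * s) = cos (u * \<bar>s\<bar>)" for s
      using cos_abs_real[of "u * s"] u by (simp add: abs_mult)
    consider "u \<le> theta" | "theta \<le> u" "u \<le> 5" | "5 \<le> u" "u \<le> 31/5" | "31/5 \<le> u" by linarith
    then show ?thesis
    proof cases
      case 1
      have "(LINT s:N|lborel. weight s * (cos (theta * x * s) - cos (u * s))) \<le> wint (\<lambda>s. 8095/10000 * s ^ (2 * 1))"
      proof (rule set_integral_le_wint[OF _ _ N])
        fix s :: real assume s: "\<bar>s\<bar> \<le> 1"
        have "1 - cos (u * s) \<le> 8095/10000 * s\<^sup>2 - 1032/10000 * s ^ 4"
          using s u 1 by (intro one_minus_cos_theta_le) (auto simp: abs_mult mult_right_mono)
        moreover have "0 \<le> s ^ 4" by simp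
        ultimately have "1 - cos (u * s) \<le> 8095/10000 * s\<^sup>2" by linarith
        then have "cos (theta * x * s) - cos (u * s) \<le> 8095/10000 * s\<^sup>2"
          using cos_le_one[of "theta * x * s"] by linarith
        then show "cos (theta * x * s) - cos (u * s) \<le> 8095/10000 * s ^ (2 * 1)" by simp
      qed (auto intro!: continuous_intros)
      also have "\<dots> = 8095/10000 * moment 1" by (simp only: wint_cmult wint_power)
      finally show ?thesis using weight_bounds[OF x] by (simp add: moment_def)
    next
      case 2
      show ?thesis
      proof (rule weighted_cos_diff_le_wint[OF N x, where l = "\<lambda>_. 0"])
        fix s :: real assume s: "\<bar>s\<bar> \<le> 1"
        have "cos (u * \<bar>s\<bar>) \<le> cos (theta * \<bar>s\<bar>)"
        proof (cases "u * \<bar>s\<bar> \<le> pi")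
          case True
          then show ?thesis using th 2 by (intro cos_monotone_0_pi_le) (auto intro: mult_right_mono)
        next
          case False
          have "(u + theta) * \<bar>s\<bar> \<le> 6.28 * 1" using 2 s theta_bounds by (intro mult_mono) auto
          then have "theta * \<bar>s\<bar> \<le> 2 * pi - u * \<bar>s\<bar>" using pi_bounds by (simp add: algebra_simps)
          then have "cos (2 * pi - u * \<bar>s\<bar>) \<le> cos (theta * \<bar>s\<bar>)"
            using False th by (intro cos_monotone_0_pi_le) auto
          then show ?thesis by (simp add: cos_diff)
        qed
        then show "cos (u * s) - cos (theta * x * s) \<le> 0"
          using cos_theta[OF s] cos_abs[of s] by linarith
      next
        have "u\<^sup>2 \<le> 5\<^sup>2" using 2 u by (intro power_mono) auto
        then have "0 \<le> poly_list cos_poly (u\<^sup>2 / 40)" by (intro cos_poly_nonneg) auto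
        also have "\<dots> \<le> 9/20 * wint (\<lambda>s. cos (u * s)) + 159/1000"
          using wint_cos_lower[of u] by simp
        finally show "9/20 * wint (\<lambda>s. 0 - cos (u * s)) \<le> 159/1000"
          using wint_cmult[of "-1" "\<lambda>s. cos (u * s)"] by simp
      qed auto
    next
      case 3
      show ?thesis
      proof (rule weighted_cos_diff_le_wint[OF N x, where l = "\<lambda>s. (u - 5) * s ^ (2 * 3)"])
        fix s :: real assume s: "\<bar>s\<bar> \<le> 1"
        show "cos (u * s) - cos (theta * x * s) \<le> (u - 5) * s ^ (2 * 3)"
          using cos_diff_le_bernoulli[of u "\<bar>s\<bar>"] 3 s cos_theta[OF s] cos_abs[of s] by (simp add: power_even_abs)
      next
        have "5\<^sup>2 \<le> u\<^sup>2" "u\<^sup>2 \<le> (31/5)\<^sup>2" using 3 by (intro power_mono; simp)+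
        then have "108617/1000000 * ((40 * (u\<^sup>2 / 40) - 2464/100) / (112/10)) \<le> poly_list cos_poly (u\<^sup>2 / 40)"
          by (intro cos_poly_ge_line) (auto simp: power_divide)
        also have "\<dots> \<le> 9/20 * wint (\<lambda>s. cos (u * s)) + 159/1000"
          using wint_cos_lower[of u] by simp
        finally have 1: "108617/1000000 * ((u\<^sup>2 - 2464/100) / (112/10)) \<le> 9/20 * wint (\<lambda>s. cos (u * s)) + 159/1000"
          by simp
        \<comment> \<open>the parabola lies above its tangent at 5.6, which is the line in question read in \<open>u\<^sup>2\<close>\<close>
        have "0 \<le> (u - 56/10)\<^sup>2" by simp
        then have 2: "u - 5 \<le> (u\<^sup>2 - 2464/100) / (112/10)" by (simp add: power2_eq_square field_simps)
        have "wint (\<lambda>s. (u - 5) * s ^ (2 * 3) - cos (u * s)) = (u - 5) * moment 3 - wint (\<lambda>s. cos (u * s))"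
          by (subst wint_diff) (auto intro!: continuous_intros simp: wint_cmult wint_power[of 3, simplified])
        moreover have "9/20 * ((u - 5) * moment 3) \<le> 108617/1000000 * (u - 5)"
        proof -
          have "(9/20 * moment 3) * (u - 5) \<le> 108617/1000000 * (u - 5)"
            using 3 by (intro mult_right_mono) (auto simp: moment_def)
          then show ?thesis by (simp only: mult_ac)
        qed
        moreover have "108617/1000000 * (u - 5) \<le> 108617/1000000 * ((u\<^sup>2 - 2464/100) / (112/10))"
          using 2 by (rule mult_left_mono) simp
        ultimately show "9/20 * wint (\<lambda>s. (u - 5) * s ^ (2 * 3) - cos (u * s)) \<le> 159/1000"
          using 1 by linarith
      qed (use 3 in \<open>auto intro!: continuous_intros\<close>)
    next
      case 4
      define e where "e s = 8095/10000 * s\<^sup>2 - 1032/10000 * s ^ 4" for s :: real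
      show ?thesis
      proof (rule weighted_cos_diff_le_wint[OF N x, where l = "\<lambda>s. e s * (1 + cos (u * s)) / 2"])
        fix s :: real assume s: "\<bar>s\<bar> \<le> 1"
        define p where "p = cos (theta * x * s)"
        define q where "q = cos (u * s)"
        have b: "0 \<le> 1 - q" "0 \<le> 1 + q" "0 \<le> 1 + p" "0 \<le> 1 - p"
          using cos_ge_minus_one[of "theta * x * s"] cos_le_one[of "theta * x * s"]
            cos_ge_minus_one[of "u * s"] cos_le_one[of "u * s"]
          unfolding p_def q_def by linarith+
        have pe: "1 - p \<le> e s"
          unfolding p_def e_def using s a[of s] th by (intro one_minus_cos_theta_le) (auto simp: abs_mult)
        then show "0 \<le> e s * (1 + cos (u * s)) / 2" using b unfolding q_def by auto
        have "q - p = (1 - p) * (1 + q) / 2 - (1 + p) * (1 - q) / 2" by (simp add: field_simps)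
        also have "\<dots> \<le> (1 - p) * (1 + q) / 2" using b by simp
        also have "\<dots> \<le> e s * (1 + q) / 2" using b pe by (intro divide_right_mono mult_right_mono) auto
        finally show "cos (u * s) - cos (theta * x * s) \<le> e s * (1 + cos (u * s)) / 2"
          by (simp add: p_def q_def)
      next
        have "wint (\<lambda>s. e s * (1 + cos (u * s)) / 2 - cos (u * s))
          = wint (\<lambda>s. (8095/20000 * s ^ (2 * 1) - 1032/20000 * s ^ (2 * 2)) - cos_minorant s * cos (u * s))"
          by (intro arg_cong[where f = wint]) (auto simp: fun_eq_iff e_def cos_minorant_def field_simps power2_eq_square)
        also have "\<dots> = (8095/20000 * moment 1 - 1032/20000 * moment 2) - wint (\<lambda>s. cos_minorant s * cos (u * s))"
          unfolding cos_minorant_def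
          by (subst wint_diff, (intro continuous_intros)+, subst wint_diff, (intro continuous_intros)+)
             (simp only: wint_cmult wint_power)
        finally show "9/20 * wint (\<lambda>s. e s * (1 + cos (u * s)) / 2 - cos (u * s)) \<le> 159/1000"
          using wint_cos_minorant_cos[OF 4] by (simp add: moment_def)
      qed (auto intro!: continuous_intros simp: e_def)
    qed
  qed
  show ?thesis
  proof (cases "0 \<le> u")
    case False
    then show ?thesis using nonneg[of "- u"] by simp
  qed (rule nonneg)
qed

section \<open>The sign uncertainty inequality\<close>

definition neg_part :: "(real \<Rightarrow> real) \<Rightarrow> real \<Rightarrow> real" where
  "neg_part f x = max 0 (- f x)"

lemma neg_part_nonneg: "0 \<le> neg_part f x"
  by (simp add: neg_part_def)

lemma integrable_neg_part:
  assumes "integrable lborel f"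
  shows "integrable lborel (neg_part f)"
  unfolding neg_part_def[abs_def] using assms by auto

lemma integrable_scale:
  fixes f :: "real \<Rightarrow> real"
  assumes "integrable lborel f" "a \<noteq> 0"
  shows "integrable lborel (\<lambda>x. f (a * x))"
  using lborel_integrable_real_affine[OF assms(1), of a 0] assms(2) by simp

lemma integral_scale:
  fixes f :: "real \<Rightarrow> real"
  assumes "0 < a"
  shows "(LINT x|lborel. f x) = a * (LINT x|lborel. f (a * x))"
  using lborel_integral_real_affine[of a f 0] assms by simp

lemma integrable_weight_neg_part:
  assumes "integrable lborel f" "a \<noteq> 0"
  shows "set_integrable lborel {-1..1} (\<lambda>s. weight s * neg_part f (a * s))"
  unfolding set_integrable_def
proof (rule Bochner_Integration.integrable_bound)
  show "integrable lborel (\<lambda>s. neg_part f (a * s))"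
    by (intro integrable_scale integrable_neg_part assms)
  have [measurable]: "f \<in> borel_measurable borel" using assms by auto
  show "(\<lambda>s. indicat_real {-1..1} s *\<^sub>R (weight s * neg_part f (a * s))) \<in> borel_measurable lborel"
    unfolding weight_def neg_part_def by measurable
  show "AE s in lborel. norm (indicat_real {-1..1} s *\<^sub>R (weight s * neg_part f (a * s))) \<le> norm (neg_part f (a * s))"
  proof (intro AE_I2)
    fix s :: real
    show "norm (indicat_real {-1..1} s *\<^sub>R (weight s * neg_part f (a * s))) \<le> norm (neg_part f (a * s))"
    proof (cases "\<bar>s\<bar> \<le> 1")
      case True
      then have "\<bar>weight s\<bar> \<le> 1" using weight_bounds[OF True] by linarith
      then show ?thesis by (auto simp: indicator_def abs_mult intro!: mult_left_le_one_le)
    qed (auto simp: indicator_def)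
  qed
qed

text \<open>The inversion formula and Fubini turn the left-hand side into a pairing of \<open>- F (b v)\<close> with
  \<open>C v\<close>. Once a constant has made this multiplier nonnegative, \<open>- F\<close> may be replaced by its positive
  part. That part vanishes for \<open>\<bar>v\<bar> > 1\<close>, and on \<open>[-1, 1]\<close> the multiplier is at most a multiple of
  the weight.\<close>

lemma neg_part_mass_le:
  assumes ab: "0 < a" "0 < b" "a * b = 81/400"
    and f: "f \<in> borel_measurable borel" and F: "integrable lborel F"
    and inv: "\<And>x. f x = cos_transform F x" and F0: "cos_transform F 0 \<le> 0"
    and Fb: "\<And>y. \<bar>y\<bar> > b \<Longrightarrow> 0 \<le> F y"
  shows "wint (\<lambda>s. neg_part f (a * s)) \<le> b * (20/9 * 999/1000) * wint (\<lambda>s. neg_part F (b * s))"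
proof -
  define N where "N = {s \<in> {-1..1}. f (a * s) < 0}"
  define C where "C v = (LINT s:N|lborel. weight s * cos (theta * v * s))" for v
  define g where "g s = indicat_real N s * weight s" for s
  define h where "h v = F (b * v)" for v
  have [measurable]: "f \<in> borel_measurable borel" "F \<in> borel_measurable borel" using f F by auto
  have N [measurable]: "N \<in> sets borel" unfolding N_def by measurable
  have N1: "N \<subseteq> {-1..1}" by (auto simp: N_def)
  have cw: "continuous_on UNIV (\<lambda>s. weight s * cos (c * s))" for c
    by (intro continuous_intros)
  have intN: "set_integrable lborel N (\<lambda>s. weight s * cos (c * s))" for c
    using set_integrable_subset[OF set_integrable_continuous[OF cw]] N N1 by auto
  have g: "integrable lborel g"
    using intN[of 0] by (simp add: g_def[abs_def] set_integrable_def)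
  have h: "integrable lborel h"
    unfolding h_def using F ab by (intro integrable_scale) auto
  have C_eq: "C v = (LINT s|lborel. g s * cos (theta * v * s))" for v
    by (simp add: C_def g_def set_lebesgue_integral_def mult.assoc)
  have C_bound: "\<bar>C v\<bar> \<le> (LINT s|lborel. \<bar>g s\<bar>)" for v
    unfolding C_eq
  proof (rule order_trans[OF integral_abs_bound])
    show "(LINT s|lborel. \<bar>g s * cos (theta * v * s)\<bar>) \<le> (LINT s|lborel. \<bar>g s\<bar>)"
    proof (rule integral_mono)
      show "integrable lborel (\<lambda>s. \<bar>g s * cos (theta * v * s)\<bar>)"
        using integrable_mult_cos[OF g, of "theta * v" 1] by simp
    qed (use g in \<open>auto simp: abs_mult intro!: mult_left_le\<close>)
  qed
  have bdd: "bdd_above (range (\<lambda>v. max 0 (- C v)))"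
    by (rule bdd_aboveI[of _ "LINT s|lborel. \<bar>g s\<bar>"]) (use C_bound abs_ge_minus_self in \<open>fastforce simp: abs_le_iff\<close>)
  \<comment> \<open>the least constant that makes \<open>C + c\<close> nonnegative, and not below 0\<close>
  define c where "c = (SUP v. max 0 (- C v))"
  have c: "max 0 (- C v) \<le> c" for v
    unfolding c_def by (rule cSUP_upper[OF _ bdd]) simp
  have kernel: "C v + c \<le> (20/9 * 999/1000) * weight v" if v: "\<bar>v\<bar> \<le> 1" for v
  proof -
    \<comment> \<open>the additive slack becomes a factor below 1, since the weight is at most 1\<close>
    have w: "weight v - 1/1000 \<le> 999/1000 * weight v" using weight_bounds[OF v] by linarith
    have "C v + max 0 (- C v') \<le> (20/9 * 999/1000) * weight v" for v'
    proof -
      have "C v - C v' = (LINT s:N|lborel. weight s * (cos (theta * v * s) - cos (theta * v' * s)))"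
        unfolding C_def right_diff_distrib by (rule set_integral_diff(2)[symmetric, OF intN intN])
      then show ?thesis
        using weighted_cos_diff_bound[OF N N1 v, of "theta * v'"] weighted_cos_bound[OF N N1 v] w
        unfolding C_def[symmetric] by (simp add: max_def)
    qed
    then have "c \<le> (20/9 * 999/1000) * weight v - C v"
      unfolding c_def by (intro cSUP_least) (auto simp: algebra_simps)
    then show ?thesis by simp
  qed
  have Cm [measurable]: "C \<in> borel_measurable borel"
    unfolding C_eq[abs_def] g_def weight_def by measurable
  have hC: "integrable lborel (\<lambda>v. h v * C v)"
  proof (rule Bochner_Integration.integrable_bound)
    show "integrable lborel (\<lambda>v. (LINT s|lborel. \<bar>g s\<bar>) * h v)" using h by simp
    show "AE v in lborel. norm (h v * C v) \<le> norm ((LINT s|lborel. \<bar>g s\<bar>) * h v)"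
    proof (intro AE_I2)
      fix v
      have "\<bar>C v\<bar> * \<bar>h v\<bar> \<le> \<bar>LINT s|lborel. \<bar>g s\<bar>\<bar> * \<bar>h v\<bar>"
        using C_bound[of v] by (intro mult_right_mono) auto
      then show "norm (h v * C v) \<le> norm ((LINT s|lborel. \<bar>g s\<bar>) * h v)"
        by (simp add: abs_mult mult.commute)
    qed
  qed (auto simp: h_def)
  have f_eq: "f (a * s) = b * (LINT v|lborel. h v * cos (theta * v * s))" for s
  proof -
    have arg: "2 * pi * (b * v) * (a * s) = theta * v * s" for v
    proof -
      have "2 * pi * (b * v) * (a * s) = 2 * pi * (a * b) * v * s" by simp
      then show ?thesis by (simp add: ab theta_def)
    qed
    have "f (a * s) = (LINT t|lborel. F t * cos (2 * pi * t * (a * s)))"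
      by (simp add: inv cos_transform_def)
    also have "\<dots> = b * (LINT v|lborel. F (b * v) * cos (2 * pi * (b * v) * (a * s)))"
      by (rule integral_scale) (use ab in simp)
    finally show ?thesis by (simp only: arg h_def)
  qed
  have "wint (\<lambda>s. neg_part f (a * s)) = (LINT s|lborel. g s * (- f (a * s)))"
    unfolding wint_def set_lebesgue_integral_def
    by (intro Bochner_Integration.integral_cong) (auto simp: g_def N_def neg_part_def indicator_def)
  also have "\<dots> = (LINT s|lborel. (- b) * (LINT v|lborel. g s * h v * cos (theta * v * s)))"
    by (simp add: f_eq mult.assoc mult.left_commute)
  also have "\<dots> = (- b) * (LINT s|lborel. (LINT v|lborel. g s * h v * cos (theta * v * s)))"
    by simp
  also have "(LINT s|lborel. (LINT v|lborel. g s * h v * cos (theta * v * s)))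
      = (LINT v|lborel. (LINT s|lborel. g s * h v * cos (theta * v * s)))"
  proof (rule lborel_pair.Fubini_integral[symmetric])
    have "integrable (lborel \<Otimes>\<^sub>M lborel) (\<lambda>(s, v). g s * h v * cos (theta * snd (s, v) * fst (s, v)))"
      by (rule integrable_product_bounded[OF g h])
         (auto intro!: borel_measurable_continuous_onI continuous_intros)
    then show "integrable (lborel \<Otimes>\<^sub>M lborel) (\<lambda>(s, v). g s * h v * cos (theta * v * s))" by simp
  qed
  also have "\<dots> = (LINT v|lborel. h v * C v)"
    unfolding C_eq Bochner_Integration.integral_mult_right_zero[symmetric] by (simp only: mult_ac)
  \<comment> \<open>adding and subtracting \<open>c\<close>; the correction has the right sign because \<open>F\<close> has nonpositive integral\<close>
  also have "(- b) * \<dots> = b * ((LINT v|lborel. - h v * (C v + c)) + c * (LINT v|lborel. h v))"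
    using hC h by (simp add: distrib_left algebra_simps)
  also have "\<dots> \<le> b * (wint (\<lambda>v. (20/9 * 999/1000) * neg_part F (b * v)) + 0)"
  proof (intro mult_left_mono add_mono)
    have "b * (LINT v|lborel. h v) = (LINT y|lborel. F y)"
      unfolding h_def by (rule integral_scale[symmetric]) (use ab in simp)
    also have "\<dots> \<le> 0" using F0 by (simp add: cos_transform_def)
    finally have "(LINT v|lborel. h v) \<le> 0" using ab by (simp add: mult_le_0_iff)
    moreover have "0 \<le> c" using c[of 0] by simp
    ultimately show "c * (LINT v|lborel. h v) \<le> 0" by (simp add: mult_nonneg_nonpos)
    show "(LINT v|lborel. - h v * (C v + c)) \<le> wint (\<lambda>v. (20/9 * 999/1000) * neg_part F (b * v))"
      unfolding wint_def set_lebesgue_integral_def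
    proof (rule integral_mono)
      show "integrable lborel (\<lambda>v. - h v * (C v + c))"
        using hC h by (simp add: distrib_left)
      have "integrable lborel (\<lambda>v. (20/9 * 999/1000) * (indicat_real {-1..1} v *\<^sub>R (weight v * neg_part F (b * v))))"
        using integrable_weight_neg_part[OF F, of b] ab by (simp add: set_integrable_def)
      then show "integrable lborel (\<lambda>v. indicat_real {-1..1} v *\<^sub>R (weight v * ((20/9 * 999/1000) * neg_part F (b * v))))"
        by (simp add: mult_ac)
      fix v :: real
      have pos: "0 \<le> C v + c" using c[of v] by simp
      show "- h v * (C v + c) \<le> indicat_real {-1..1} v *\<^sub>R (weight v * ((20/9 * 999/1000) * neg_part F (b * v)))"
      proof (cases "\<bar>v\<bar> \<le> 1")
        case True
        have "- h v * (C v + c) \<le> neg_part F (b * v) * (C v + c)"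
          using pos by (intro mult_right_mono) (auto simp: h_def neg_part_def)
        also have "\<dots> \<le> neg_part F (b * v) * ((20/9 * 999/1000) * weight v)"
          using kernel[OF True] by (intro mult_left_mono) (auto simp: neg_part_nonneg)
        finally show ?thesis using True by (auto simp: indicator_def abs_le_iff mult_ac)
      next
        case False
        have "b * 1 < b * \<bar>v\<bar>" using False ab by (intro mult_strict_left_mono) auto
        then have "0 \<le> h v" using Fb[of "b * v"] ab by (simp add: h_def abs_mult)
        then have "- h v * (C v + c) \<le> 0" using pos by (simp add: mult_nonneg_nonneg)
        moreover have "indicat_real {-1..1} v = 0" using False by (auto simp: indicator_def)
        ultimately show ?thesis by simp
      qed
    qed
  qed (use ab in simp)
  also have "\<dots> = b * (20/9 * 999/1000) * wint (\<lambda>s. neg_part F (b * s))"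
    by (simp only: wint_cmult) simp
  finally show ?thesis .
qed

lemma continuous_AE_zero_imp_zero:
  fixes f :: "real \<Rightarrow> real"
  assumes "continuous_on UNIV f" "AE x in lborel. f x = 0"
  shows "f = (\<lambda>x. 0)"
proof -
  have "open {x. f x \<noteq> 0}"
    using assms(1) by (intro open_Collect_neq) auto
  moreover have "{x. f x \<noteq> 0} \<in> null_sets lborel"
  proof -
    obtain S where S: "{x. f x \<noteq> 0} \<subseteq> S" "S \<in> null_sets lborel"
      using assms(2) by (auto simp: eventually_ae_filter)
    have "{x. f x \<noteq> 0} \<in> sets lborel" using \<open>open _\<close> by auto
    then show ?thesis using S null_sets_subset by blast
  qed
  then have "negligible {x. f x \<noteq> 0}"
    by (simp add: negligible_iff_null_sets null_sets_completionI)
  ultimately have "{x. f x \<noteq> 0} = {}"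
    using open_not_negligible by blast
  then show ?thesis by auto
qed

lemma AE_zero_of_AE_nonneg:
  fixes g :: "real \<Rightarrow> real"
  assumes "integrable lborel g" "(LINT x|lborel. g x) \<le> 0" "AE x in lborel. 0 \<le> g x"
  shows "AE x in lborel. g x = 0"
proof -
  have "0 \<le> (LINT x|lborel. g x)" using assms(3) by (rule integral_nonneg_AE)
  then have "(LINT x|lborel. g x) = 0" using assms(2) by simp
  then show ?thesis using integral_nonneg_eq_0_iff_AE[OF assms(1,3)] by simp
qed

text \<open>Applying the comparison to \<open>(f, F)\<close> and to \<open>(F, f)\<close> multiplies the constants to
  \<open>a b (20/9)\<^sup>2 0.999\<^sup>2 = 0.999\<^sup>2 < 1\<close>.\<close>

lemma sign_uncertainty:
  assumes ab: "0 < a" "0 < b" "a * b = 81/400"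
    and cont: "continuous_on UNIV f" and f: "integrable lborel f" and F: "integrable lborel F"
    and FT: "F = cos_transform f" and inv: "f = cos_transform F"
    and "f 0 \<le> 0" "F 0 \<le> 0"
    and fa: "\<And>x. \<bar>x\<bar> > a \<Longrightarrow> 0 \<le> f x" and Fb: "\<And>y. \<bar>y\<bar> > b \<Longrightarrow> 0 \<le> F y"
  shows "f = (\<lambda>x. 0)"
proof -
  have [measurable]: "f \<in> borel_measurable borel" "F \<in> borel_measurable borel" using f F by auto
  let ?K = "20/9 * 999/1000 :: real"
  define P where "P = wint (\<lambda>s. neg_part f (a * s))"
  define Q where "Q = wint (\<lambda>s. neg_part F (b * s))"
  have F': "cos_transform F 0 \<le> 0" "cos_transform f 0 \<le> 0"
    using \<open>f 0 \<le> 0\<close> \<open>F 0 \<le> 0\<close> fun_cong[OF inv, of 0] fun_cong[OF FT, of 0] by simp_all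
  have PQ: "P \<le> b * ?K * Q"
    unfolding P_def Q_def
    by (rule neg_part_mass_le[OF ab _ F fun_cong[OF inv] F'(1) Fb]) auto
  have ba: "b * a = 81/400" using ab by (simp add: mult.commute)
  have QP: "Q \<le> a * ?K * P"
    unfolding P_def Q_def
    by (rule neg_part_mass_le[OF ab(2,1) ba _ f fun_cong[OF FT] F'(2) fa]) auto
  have P0: "0 \<le> P"
    unfolding P_def wint_def set_lebesgue_integral_def
    using weight_bounds(1) neg_part_nonneg
    by (intro integral_nonneg_AE AE_I2) (fastforce simp: indicator_def abs_le_iff intro!: mult_nonneg_nonneg)
  have "b * ?K * Q \<le> b * ?K * (a * ?K * P)"
    using ab by (intro mult_left_mono QP) simp
  with PQ have "P \<le> b * ?K * (a * ?K * P)" by (rule order_trans)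
  also have "\<dots> = (a * b) * ?K\<^sup>2 * P" by (simp add: power2_eq_square)
  also have "\<dots> = (999/1000)\<^sup>2 * P" unfolding ab by (simp add: power2_eq_square)
  finally have "P = 0" using P0 by (simp add: power2_eq_square)
  have "AE s in lborel. neg_part f (a * s) = 0"
  proof -
    have "AE s in lborel. indicat_real {-1..1} s *\<^sub>R (weight s * neg_part f (a * s)) = 0"
    proof (rule AE_zero_of_AE_nonneg)
      show "integrable lborel (\<lambda>s. indicat_real {-1..1} s *\<^sub>R (weight s * neg_part f (a * s)))"
        using integrable_weight_neg_part[OF f, of a] ab by (simp add: set_integrable_def)
      show "(LINT s|lborel. indicat_real {-1..1} s *\<^sub>R (weight s * neg_part f (a * s))) \<le> 0"
        using \<open>P = 0\<close> by (simp add: P_def wint_def set_lebesgue_integral_def)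
      show "AE s in lborel. 0 \<le> indicat_real {-1..1} s *\<^sub>R (weight s * neg_part f (a * s))"
        using weight_bounds(1) neg_part_nonneg
        by (intro AE_I2) (fastforce simp: indicator_def abs_le_iff intro!: mult_nonneg_nonneg)
    qed
    then show ?thesis
    proof eventually_elim
      case (elim s)
      show ?case
      proof (cases "\<bar>s\<bar> \<le> 1")
        case True
        then show ?thesis using elim weight_bounds(1)[OF True] by (auto simp: indicator_def abs_le_iff)
      next
        case False
        have "a * 1 < a * \<bar>s\<bar>" using False ab by (intro mult_strict_left_mono) auto
        then show ?thesis using fa[of "a * s"] ab by (simp add: neg_part_def abs_mult)
      qed
    qed
  qed
  then have "(LINT s|lborel. neg_part f (a * s)) = 0"
    by (rule integral_eq_zero_AE)
  then have neg0: "(LINT x|lborel. neg_part f x) = 0"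
    using integral_scale[OF ab(1), of "neg_part f"] by simp
  have "(LINT x|lborel. \<bar>f x\<bar>) = (LINT x|lborel. f x + 2 * neg_part f x)"
    by (intro Bochner_Integration.integral_cong) (auto simp: neg_part_def)
  also have "\<dots> = (LINT x|lborel. f x) + 2 * 0"
    using f integrable_neg_part[OF f] by (simp add: neg0)
  also have "\<dots> = F 0" using fun_cong[OF FT, of 0] by (simp add: cos_transform_def)
  finally have "AE x in lborel. \<bar>f x\<bar> = 0"
    using f \<open>F 0 \<le> 0\<close> by (intro AE_zero_of_AE_nonneg) auto
  then show ?thesis using cont by (intro continuous_AE_zero_imp_zero) auto
qed

lemma AE_nonneg_of_A_eq_0:
  assumes "A g = 0"
  shows "AE x in lborel. 0 \<le> g x"
proof -
  have "0 \<le> g x" if "x \<noteq> 0" for x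
  proof -
    have "A g < ennreal \<bar>x\<bar>" using assms that by simp
    then obtain r where "r > 0" "\<forall>x. \<bar>x\<bar> > r \<longrightarrow> 0 \<le> g x" "ennreal r < ennreal \<bar>x\<bar>"
      unfolding A_def Inf_less_iff by auto
    then show ?thesis by (auto simp: ennreal_less_iff)
  qed
  then show ?thesis using AE_lborel_singleton[of 0] by (auto elim: eventually_mono)
qed

lemma A_less_imp:
  assumes "A g < ennreal c"
  obtains r where "0 < r" "r < c" "\<And>x. \<bar>x\<bar> > r \<Longrightarrow> 0 \<le> g x"
  using assms unfolding A_def Inf_less_iff by (auto simp: ennreal_less_iff)

text \<open>The infima need not be attained, but strict inequality leaves room to choose \<open>a\<close> above the first,
  and \<open>b = 0.2025 / a\<close> above the second. For this, both infima must be positive: if one were 0, the function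
  would be nonnegative with nonpositive integral.\<close>

lemma constant_lower_bound:
  assumes adm: "admissible f"
  shows "A f * A (fourier_real f) \<ge> ennreal 0.2025"
proof (rule ccontr)
  assume less: "\<not> A f * A (fourier_real f) \<ge> ennreal 0.2025"
  define F where "F = fourier_real f"
  have cont: "continuous_on UNIV f" and f: "integrable lborel f" and even: "\<And>x. f (- x) = f x"
    and nz: "f \<noteq> (\<lambda>x. 0)" and f0: "f 0 \<le> 0" and F0: "F 0 \<le> 0"
    and "integrable lborel (fourier f)"
    using adm by (auto simp: admissible_def F_def)
  then have F: "integrable lborel F"
    unfolding F_def fourier_real_def[abs_def] by (intro integrable_Re)
  have FT: "F = cos_transform f"
    unfolding F_def by (rule fourier_real_eq_cos_transform[OF f])
  have inv: "f = cos_transform F"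
    using cos_transform_inversion[OF cont f even] F unfolding FT by (simp add: fun_eq_iff)
  have "A f \<noteq> 0"
  proof
    assume "A f = 0"
    then have "AE x in lborel. f x = 0"
      using f F0 fun_cong[OF FT, of 0]
      by (intro AE_zero_of_AE_nonneg AE_nonneg_of_A_eq_0) (simp_all add: cos_transform_def)
    then show False using continuous_AE_zero_imp_zero[OF cont] nz by simp
  qed
  moreover have "A F \<noteq> 0"
  proof
    assume "A F = 0"
    then have "AE y in lborel. F y = 0"
      using F f0 fun_cong[OF inv, of 0]
      by (intro AE_zero_of_AE_nonneg AE_nonneg_of_A_eq_0) (simp_all add: cos_transform_def)
    then have "cos_transform F x = 0" for x
      unfolding cos_transform_def by (intro integral_eq_zero_AE) auto
    then have "f x = 0" for x using fun_cong[OF inv, of x] by simp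
    then show False using nz by auto
  qed
  moreover have "A f * A F < ennreal 0.2025" using less by (simp add: F_def)
  ultimately have "A f \<noteq> \<top>" "A F \<noteq> \<top>" by (auto simp: ennreal_top_mult ennreal_mult_top)
  then obtain p q where p: "A f = ennreal p" "0 \<le> p" and q: "A F = ennreal q" "0 \<le> q"
    by (cases "A f"; cases "A F") auto
  have "0 < p" "0 < q" using p q \<open>A f \<noteq> 0\<close> \<open>A F \<noteq> 0\<close> by (auto simp: less_le)
  have "p * q < 81/400"
    using \<open>A f * A F < ennreal 0.2025\<close> p q by (simp add: ennreal_less_iff flip: ennreal_mult)
  then have "A f < ennreal (81/400 / q)"
    using \<open>0 < q\<close> p by (simp add: ennreal_less_iff pos_less_divide_eq)
  then obtain a where a: "0 < a" "a < 81/400 / q" "\<And>x. \<bar>x\<bar> > a \<Longrightarrow> 0 \<le> f x"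
    by (rule A_less_imp) blast
  then have "A F < ennreal (81/400 / a)"
    using \<open>0 < q\<close> q by (simp add: ennreal_less_iff field_simps)
  then obtain b where b: "0 < b" "b < 81/400 / a" "\<And>y. \<bar>y\<bar> > b \<Longrightarrow> 0 \<le> F y"
    by (rule A_less_imp) blast
  have "f = (\<lambda>x. 0)"
  proof (rule sign_uncertainty[OF _ _ _ cont f F FT inv f0 F0 a(3)])
    show "0 \<le> F y" if "\<bar>y\<bar> > 81/400 / a" for y
      using b that by auto
  qed (use a in auto)
  with nz show False by simp
qed

theorem theorem2:
  "(\<forall>f. admissible f \<longrightarrow> A f * A (fourier_real f) \<ge> ennreal 0.2025) \<and>
   \<not> (\<forall>f. admissible f \<longrightarrow> A f * A (fourier_real f) \<ge> ennreal 0.353)"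
  using constant_lower_bound constant_upper_bound by blast

end
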